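(* Let $F$ be a digraph, let $v_0\in V(F)$, let $k\ge 1$ and let $Q\in\mathscr{S}_k$ be a good subdigraph of $\overleftrightarrow{P_k}$, where $P_k=v_1v_2\ldots v_k$ and $\{v_1,\ldots,v_k\}$ is disjoint from $V(F)$. Let $F^*$ be the digraph obtained from $F$ by adding $Q$, both arcs $(v_0,v_1)$ and $(v_1,v_0)$, and, if $k\ge 2$, exactly one of the arcs $(v_0,v_k)$, $(v_k,v_0)$. Then $\mathrm{mader}_{\overrightarrow{\chi}}(F^* )\le \mathrm{mader}_{\overrightarrow{\chi}}(F)+k$.
   Context: All digraphs are finite. $(u,v)$ denotes an arc with tail $u$ and head $v$. An acyclic $k$-coloring of a digraph $D$ is a map $c:V(D)\to\{1,\ldots,k\}$ such that each color class $c^{-1}(i)$ induces a subdigraph with no directed cycle; the dichromatic number $\overrightarrow{\chi}(D)$ is the least $k$ for which $D$ has an acyclic $k$-coloring. A subdivision of a digraph $H$ is obtained by replacing each arc $(u,v)$ of $H$ by a directed path from $u$ to $v$, these paths being internally vertex-disjoint from each other and from $V(H)$; $D$ contains a subdivision of $H$ if some subdigraph of $D$ is isomorphic to such a subdivision. For a digraph $H$, $\mathrm{mader}_{\overrightarrow{\chi}}(H)$ is the smallest integer $m$ such that every digraph $D$ with $\overrightarrow{\chi}(D)\ge m$ contains a subdivision of $H$ (this is known to be finite). For a graph $G$, $\overleftrightarrow{G}$ (its biorientation) is obtained by replacing each edge $uv$ by the two arcs $(u,v)$ and $(v,u)$; a digon is such a pair of symmetric arcs. For the path $P_k=v_1v_2\ldots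 v_k$, a subdigraph $Q$ of $\overleftrightarrow{P_k}$ is called good if (a) $Q$ is connected (as an underlying graph), $|V(Q)|=k$, and all digons in $Q$ are pairwise vertex-disjoint; and (b) $d^+_Q(v_1)+d^-_Q(v_1)=1$. $\mathscr{S}_k$ denotes the set of good subdigraphs of $\overleftrightarrow{P_k}$. *)

theory Defs
  imports "Graph_Theory.Graph_Theory" "HOL-Library.Extended_Nat"
begin

text \<open>
  Digraphs are finite, without loops and without parallel arcs (digons are allowed), that is,
  \<^locale>\<open>pair_digraph\<close>. The null digraph is included; its dichromatic number is 0.
\<close>

definition acyclic_colouring :: "'a pair_pre_digraph \<Rightarrow> nat \<Rightarrow> ('a \<Rightarrow> nat) \<Rightarrow> bool" where
  "acyclic_colouring D k c \<longleftrightarrow>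
     c ` pverts D \<subseteq> {1..k} \<and>
     (\<forall>i \<in> {1..k}. \<not> (\<exists>p. pre_digraph.cycle (with_proj D \<restriction> {x \<in> pverts D. c x = i}) p))"

definition dichromatic_number :: "'a pair_pre_digraph \<Rightarrow> nat" where
  "dichromatic_number D = (LEAST k. \<exists>c. acyclic_colouring D k c)"

text \<open>
  \<^term>\<open>P e\<close> is the directed path (a list of arcs) that replaces the arc \<^term>\<open>e\<close>;
  it may consist of \<^term>\<open>e\<close> alone. As \<^term>\<open>H\<close> has no loops, the path is never empty.
\<close>

definition subdivision_of :: "'a pair_pre_digraph \<Rightarrow> 'a pair_pre_digraph \<Rightarrow> bool" where
  "subdivision_of S H \<longleftrightarrow> (\<exists>P.
     (\<forall>e \<in> parcs H. pre_digraph.apath (with_proj S) (fst e) (P e) (snd e)) \<and>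
     (\<forall>e \<in> parcs H. set (pre_digraph.inner_verts (with_proj S) (P e)) \<inter> pverts H = {}) \<and>
     (\<forall>e \<in> parcs H. \<forall>e' \<in> parcs H. e \<noteq> e' \<longrightarrow>
        set (pre_digraph.inner_verts (with_proj S) (P e)) \<inter>
        set (pre_digraph.inner_verts (with_proj S) (P e')) = {}) \<and>
     pverts S = pverts H \<union> (\<Union>e \<in> parcs H. set (pre_digraph.inner_verts (with_proj S) (P e))) \<and>
     parcs S = (\<Union>e \<in> parcs H. set (P e)))"

text \<open>
  A subdigraph of \<^term>\<open>D\<close> is isomorphic to a subdivision of \<^term>\<open>H\<close> iff it is a subdivision
  of an isomorphic copy \<^term>\<open>H'\<close> of \<^term>\<open>H\<close>. The copy is needed since \<^term>\<open>D\<close> and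
  \<^term>\<open>H\<close> may have different vertex types.
\<close>

definition contains_subdivision :: "'b pair_pre_digraph \<Rightarrow> 'a pair_pre_digraph \<Rightarrow> bool" where
  "contains_subdivision D H \<longleftrightarrow>
     (\<exists>S H'. subgraph (with_proj S) (with_proj D) \<and>
        digraph_iso (with_proj H) (with_proj H') \<and> subdivision_of S H')"

text \<open>
  Every finite digraph is isomorphic to one with vertices in \<^typ>\<open>nat\<close>, so quantifying over these
  covers all finite digraphs. The infimum in \<^typ>\<open>enat\<close> is the least such \<^term>\<open>m\<close>; it would be
  infinite if there were none.
\<close>

definition mader :: "'a pair_pre_digraph \<Rightarrow> enat" where
  "mader H = Inf {enat m | m. \<forall>D :: nat pair_pre_digraph.
     pair_digraph D \<longrightarrow> m \<le> dichromatic_number D \<longrightarrow> contains_subdivision D H}"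

text \<open>An undirected graph is given by its vertex set and the set of its (two-element) edges.\<close>

definition biorientation :: "'a set \<Rightarrow> 'a set set \<Rightarrow> 'a pair_pre_digraph" where
  "biorientation V E = \<lparr>pverts = V, parcs = {(x, y). x \<noteq> y \<and> {x, y} \<in> E}\<rparr>"

definition bioriented_path :: "(nat \<Rightarrow> 'a) \<Rightarrow> nat \<Rightarrow> 'a pair_pre_digraph" where
  "bioriented_path v k = biorientation (v ` {1..k}) {{v i, v (Suc i)} | i. 1 \<le> i \<and> i < k}"

definition digons :: "'a pair_pre_digraph \<Rightarrow> 'a set set" where
  "digons Q = {{x, y} | x y. (x, y) \<in> parcs Q \<and> (y, x) \<in> parcs Q}"

text \<open>
  For \<open>k = 1\<close> the path has no arcs and the degree condition on \<open>v\<^sub>1\<close> is void, so that the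
  single vertex is good. (Read literally, the condition would leave no good subdigraph for \<open>k = 1\<close>.)
\<close>

definition good_subdigraphs :: "(nat \<Rightarrow> 'a) \<Rightarrow> nat \<Rightarrow> 'a pair_pre_digraph set" where
  "good_subdigraphs v k = {Q.
     subgraph (with_proj Q) (with_proj (bioriented_path v k)) \<and>
     connected (with_proj Q) \<and> card (pverts Q) = k \<and> pairwise disjnt (digons Q) \<and>
     (2 \<le> k \<longrightarrow> out_degree (with_proj Q) (v 1) + in_degree (with_proj Q) (v 1) = 1)}"

end

theory Submission
  imports Defs
begin

text \<open>
  Let \<open>m = mader F\<close>, let \<open>D\<close> have dichromatic number at least \<open>m + k\<close>, and let \<open>X\<close> be a maximal
  \<open>k\<close>-colourable vertex set. Then \<open>D - X\<close> contains a subdivision of \<open>F\<close>; let \<open>x\<close> play the role of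
  \<open>v\<^sub>0\<close> in it. It suffices to find a subdivision of the rest of \<open>F'\<close>, rooted at \<open>x\<close>, in \<open>X \<union> {x}\<close>,
  which is not \<open>k\<close>-colourable.

  Give \<open>x\<close> colour \<open>k\<close> and repair the colouring of \<open>X\<close> by a Kempe-like shift: as long as some new
  class contains a directed cycle, push the vertices of this cycle that have not yet been pushed to
  the next lower colour (from \<open>1\<close> to \<open>k\<close>). The shift cannot produce a colouring, so it gets stuck with
  a cycle through \<open>x\<close> and some pushed vertex. Tracing back which cycle pushed which vertex gives a closed
  chain of more than \<open>k\<close> cycles through \<open>x\<close> in which only neighbouring cycles meet. Each cycle of the
  chain can serve as an arc in either direction, or as a digon if both its neighbours serve as single
  arcs; this is why the digons of \<open>Q\<close> have to be disjoint. The surplus cycles are absorbed by the path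
  that replaces the arc between \<open>v\<^sub>k\<close> and \<open>v\<^sub>0\<close>.
\<close>

section \<open>Directed paths and cycles\<close>

definition dipath :: "'a rel \<Rightarrow> 'a list \<Rightarrow> bool" where
  "dipath E xs \<longleftrightarrow> xs \<noteq> [] \<and> distinct xs \<and> successively (\<lambda>a b. (a, b) \<in> E) xs"

text \<open>The cycle is recorded by its vertex set alone; \<open>dicycle_rotate\<close> recovers a
  list that starts at any chosen vertex. A singleton counts as a cycle exactly at a loop.\<close>

definition dicycle :: "'a rel \<Rightarrow> 'a set \<Rightarrow> bool" where
  "dicycle E K \<longleftrightarrow> (\<exists>xs. dipath E xs \<and> (last xs, hd xs) \<in> E \<and> set xs = K)"

text \<open>Walks may repeat vertices, so that they can be concatenated freely;
  \<open>strong_path\<close> extracts simple paths from them.\<close>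

definition linked :: "'a rel \<Rightarrow> 'a set \<Rightarrow> 'a \<Rightarrow> 'a \<Rightarrow> bool" where
  "linked E W a b \<longleftrightarrow> (\<exists>xs. xs \<noteq> [] \<and> successively (\<lambda>a b. (a, b) \<in> E) xs \<and> set xs \<subseteq> W \<and>
     hd xs = a \<and> last xs = b)"

definition strong :: "'a rel \<Rightarrow> 'a set \<Rightarrow> bool" where
  "strong E W \<longleftrightarrow> (\<forall>a \<in> W. \<forall>b \<in> W. linked E W a b)"

lemma dipath_mono: "dipath E xs \<Longrightarrow> E \<subseteq> E' \<Longrightarrow> dipath E' xs"
  unfolding dipath_def
  using successively_mono[of "\<lambda>a b. (a, b) \<in> E" xs "\<lambda>a b. (a, b) \<in> E'"] by blast

lemma dicycle_nonempty: "dicycle E K \<Longrightarrow> K \<noteq> {}"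
  by (auto simp: dicycle_def dipath_def)

lemma dicycle_rotate:
  assumes "dicycle E K" "a \<in> K"
  obtains xs where "dipath E (a # xs)" "(last (a # xs), a) \<in> E" "set (a # xs) = K"
proof -
  obtain xs where xs: "dipath E xs" "(last xs, hd xs) \<in> E" "set xs = K"
    using assms by (auto simp: dicycle_def)
  then obtain ys zs where split: "xs = ys @ a # zs"
    using \<open>a \<in> K\<close> by (auto simp: in_set_conv_decomp)
  have "dipath E (a # zs @ ys)"
    using xs unfolding split by (cases "ys = []") (auto simp: dipath_def successively_append_iff
      successively_Cons split: if_splits)
  moreover have "(last (a # zs @ ys), a) \<in> E"
    using xs unfolding split by (cases ys rule: rev_cases) (auto simp: dipath_def successively_append_iff
      successively_Cons split: if_splits)
  moreover have "set (a # zs @ ys) = K"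
    using xs unfolding split by auto
  ultimately show thesis
    using that by blast
qed

text \<open>Without a loop at \<open>a\<close>, this supplies a second vertex on every cycle through
  \<open>a\<close>.\<close>

lemma dicycle_singleton:
  assumes "dicycle E K" "K \<subseteq> {a}"
  shows "(a, a) \<in> E"
proof -
  have "a \<in> K"
    using assms dicycle_nonempty by blast
  obtain xs where "dipath E (a # xs)" "(last (a # xs), a) \<in> E" "set (a # xs) = K"
    using dicycle_rotate[OF assms(1) \<open>a \<in> K\<close>] .
  with assms(2) show ?thesis
    by (cases xs) (auto simp: dipath_def)
qed

lemma linked_mono: "linked E U a b \<Longrightarrow> U \<subseteq> W \<Longrightarrow> linked E W a b"
  unfolding linked_def by (elim exE) (intro exI, auto)

lemma linked_trans:
  assumes "linked E W a b" "linked E W b c"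
  shows "linked E W a c"
proof -
  obtain xs where xs: "xs \<noteq> []" "successively (\<lambda>a b. (a, b) \<in> E) xs" "set xs \<subseteq> W" "hd xs = a" "last xs = b"
    using assms(1) unfolding linked_def by (elim exE conjE)
  obtain ys where ys: "ys \<noteq> []" "successively (\<lambda>a b. (a, b) \<in> E) ys" "set ys \<subseteq> W" "hd ys = b" "last ys = c"
    using assms(2) unfolding linked_def by (elim exE conjE)
  obtain zs where zs: "ys = b # zs"
    using ys(1,4) by (cases ys) auto
  have "successively (\<lambda>a b. (a, b) \<in> E) (xs @ zs)"
    using xs(2,5) ys(2) unfolding zs by (cases zs) (simp_all add: successively_append_iff)
  moreover have "last (xs @ zs) = c"
    using xs(5) ys(5) unfolding zs by (cases zs) simp_all
  ultimately show ?thesis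
    using xs(1,3,4) ys(3) unfolding linked_def zs by (intro exI[of _ "xs @ zs"]) simp
qed

lemma dicycle_strong:
  assumes "dicycle E K"
  shows "strong E K"
  unfolding strong_def
proof (intro ballI)
  fix a b assume a: "a \<in> K" and b: "b \<in> K"
  obtain xs where xs: "dipath E (a # xs)" "set (a # xs) = K"
    using dicycle_rotate[OF assms a] .
  obtain ys zs where split: "a # xs = ys @ b # zs"
    using split_list[of b "a # xs"] b xs(2) by blast
  have "hd (ys @ [b]) = a"
    using split by (cases ys) auto
  moreover have "successively (\<lambda>a b. (a, b) \<in> E) (ys @ [b])"
    using xs(1) unfolding split dipath_def by (simp add: successively_append_iff)
  moreover have "set (ys @ [b]) \<subseteq> K"
    using xs(2) unfolding split by auto
  ultimately show "linked E K a b"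
    unfolding linked_def by (intro exI[of _ "ys @ [b]"]) simp
qed

lemma strong_Un:
  assumes "strong E U" "strong E W" "U \<inter> W \<noteq> {}"
  shows "strong E (U \<union> W)"
proof -
  have U: "linked E (U \<union> W) a b" if "a \<in> U" "b \<in> U" for a b
    using assms(1) that linked_mono[of E U a b "U \<union> W"] by (simp add: strong_def)
  have W: "linked E (U \<union> W) a b" if "a \<in> W" "b \<in> W" for a b
    using assms(2) that linked_mono[of E W a b "U \<union> W"] by (simp add: strong_def)
  obtain c where "c \<in> U" "c \<in> W"
    using assms(3) by blast
  then show ?thesis
    unfolding strong_def using U W linked_trans[of E "U \<union> W" _ c] by blast
qed

text \<open>A shortest walk in \<open>W\<close> from \<open>A\<close> to \<open>B\<close> works: a
  repeated vertex, a return to \<open>A\<close> or an early visit to \<open>B\<close> would allow a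
  shortcut.\<close>

lemma strong_path:
  assumes "strong E W" "A \<subseteq> W" "B \<subseteq> W" "A \<noteq> {}" "B \<noteq> {}"
  obtains xs where "dipath E xs" "set xs \<subseteq> W" "set xs \<inter> A = {hd xs}" "set xs \<inter> B = {last xs}"
proof -
  let ?R = "\<lambda>a b. (a, b) \<in> E"
  let ?P = "\<lambda>xs. xs \<noteq> [] \<and> successively ?R xs \<and> set xs \<subseteq> W \<and> hd xs \<in> A \<and> last xs \<in> B"
  obtain a b where "a \<in> A" "b \<in> B"
    using assms by blast
  then have "linked E W a b"
    using assms(1-3) by (auto simp: strong_def)
  then obtain xs\<^sub>0 where "xs\<^sub>0 \<noteq> []" "successively ?R xs\<^sub>0" "set xs\<^sub>0 \<subseteq> W" "hd xs\<^sub>0 = a" "last xs\<^sub>0 = b"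
    unfolding linked_def by (elim exE conjE)
  then have "?P xs\<^sub>0"
    using \<open>a \<in> A\<close> \<open>b \<in> B\<close> by simp
  from ex_has_least_nat[of ?P, OF this, of length]
  obtain xs where xs: "?P xs" and least: "\<And>ys. ?P ys \<Longrightarrow> length xs \<le> length ys"
    by blast
  have "distinct xs"
  proof (rule ccontr)
    assume "\<not> distinct xs"
    then obtain as y bs cs where split: "xs = as @ [y] @ bs @ [y] @ cs"
      using not_distinct_decomp by blast
    have "?P (as @ [y] @ cs)"
      using xs unfolding split
      by (cases as; cases cs rule: rev_cases) (auto simp: successively_append_iff successively_Cons hd_append)
    then show False
      using least[of "as @ [y] @ cs"] unfolding split by simp
  qed
  moreover have "y = hd xs" if y: "y \<in> set xs" "y \<in> A" for y
  proof -
    obtain ys zs where split: "xs = ys @ y # zs"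
      using split_list[OF y(1)] by blast
    have "?P (y # zs)"
      using xs y unfolding split by (auto simp: successively_append_iff)
    then have "ys = []"
      using least[of "y # zs"] unfolding split by simp
    then show ?thesis
      by (simp add: split)
  qed
  moreover have "y = last xs" if y: "y \<in> set xs" "y \<in> B" for y
  proof -
    obtain ys zs where split: "xs = ys @ y # zs"
      using split_list[OF y(1)] by blast
    have "?P (ys @ [y])"
      using xs y unfolding split by (cases ys) (auto simp: successively_append_iff successively_Cons hd_append)
    then have "zs = []"
      using least[of "ys @ [y]"] unfolding split by simp
    then show ?thesis
      by (simp add: split)
  qed
  ultimately show thesis
    using xs by (intro that[of xs]) (auto simp: dipath_def)
qed

section \<open>Realising arcs by paths\<close>

text \<open>
  \<^term>\<open>B\<close> is the set of branch vertices, \<^term>\<open>W\<close> bounds all vertices in use, and \<^term>\<open>P e\<close> is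
  the vertex list of the path that replaces \<^term>\<open>e\<close>.
\<close>

definition realises :: "'a rel \<Rightarrow> 'a set \<Rightarrow> 'a set \<Rightarrow> 'a rel \<Rightarrow> ('a \<times> 'a \<Rightarrow> 'a list) \<Rightarrow> bool" where
  "realises E W B R P \<longleftrightarrow> B \<subseteq> W \<and>
     (\<forall>e \<in> R. dipath E (P e) \<and> hd (P e) = fst e \<and> last (P e) = snd e \<and> set (P e) \<subseteq> W \<and>
        (set (P e) - {fst e, snd e}) \<inter> B = {}) \<and>
     (\<forall>e \<in> R. \<forall>e' \<in> R. e \<noteq> e' \<longrightarrow>
        (set (P e) - {fst e, snd e}) \<inter> (set (P e') - {fst e', snd e'}) = {})"

text \<open>An inner vertex of a path of one part is not a branch vertex of that part, so the bound
  on \<open>W\<^sub>1 \<inter> W\<^sub>2\<close> keeps it out of the other part. For an arc of both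
  parts either path would do; \<open>P\<^sub>1\<close> is taken.\<close>

lemma realises_Un:
  assumes "realises E W\<^sub>1 B\<^sub>1 R\<^sub>1 P\<^sub>1" "realises E W\<^sub>2 B\<^sub>2 R\<^sub>2 P\<^sub>2" "W\<^sub>1 \<inter> W\<^sub>2 \<subseteq> B\<^sub>1 \<inter> B\<^sub>2"
  shows "realises E (W\<^sub>1 \<union> W\<^sub>2) (B\<^sub>1 \<union> B\<^sub>2) (R\<^sub>1 \<union> R\<^sub>2) (\<lambda>e. if e \<in> R\<^sub>1 then P\<^sub>1 e else P\<^sub>2 e)"
proof -
  let ?P = "\<lambda>e. if e \<in> R\<^sub>1 then P\<^sub>1 e else P\<^sub>2 e"
  let ?I = "\<lambda>P e. set (P e) - {fst e, snd e}"
  have 1: "dipath E (P\<^sub>1 e) \<and> hd (P\<^sub>1 e) = fst e \<and> last (P\<^sub>1 e) = snd e \<and> set (P\<^sub>1 e) \<subseteq> W\<^sub>1"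
      "?I P\<^sub>1 e \<inter> B\<^sub>1 = {}" if "e \<in> R\<^sub>1" for e
    using assms(1) that by (auto simp: realises_def)
  have 2: "dipath E (P\<^sub>2 e) \<and> hd (P\<^sub>2 e) = fst e \<and> last (P\<^sub>2 e) = snd e \<and> set (P\<^sub>2 e) \<subseteq> W\<^sub>2"
      "?I P\<^sub>2 e \<inter> B\<^sub>2 = {}" if "e \<in> R\<^sub>2" for e
    using assms(2) that by (auto simp: realises_def)
  have B: "B\<^sub>1 \<subseteq> W\<^sub>1" "B\<^sub>2 \<subseteq> W\<^sub>2"
    using assms by (auto simp: realises_def)
  have I1: "?I P\<^sub>1 e \<inter> W\<^sub>2 = {}" if "e \<in> R\<^sub>1" for e
    using 1[OF that] assms(3) by blast
  have I2: "?I P\<^sub>2 e \<inter> W\<^sub>1 = {}" if "e \<in> R\<^sub>2" for e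
    using 2[OF that] assms(3) by blast
  have 11: "?I P\<^sub>1 e \<inter> ?I P\<^sub>1 e' = {}" if "e \<in> R\<^sub>1" "e' \<in> R\<^sub>1" "e \<noteq> e'" for e e'
    using assms(1) that by (simp add: realises_def)
  have 22: "?I P\<^sub>2 e \<inter> ?I P\<^sub>2 e' = {}" if "e \<in> R\<^sub>2" "e' \<in> R\<^sub>2" "e \<noteq> e'" for e e'
    using assms(2) that by (simp add: realises_def)
  have 12: "?I P\<^sub>1 e \<inter> ?I P\<^sub>2 e' = {}" if "e \<in> R\<^sub>1" "e' \<in> R\<^sub>2" for e e'
    using I1[OF that(1)] 2(1)[OF that(2)] by blast
  show ?thesis
    unfolding realises_def
  proof (intro conjI ballI impI)
    show "B\<^sub>1 \<union> B\<^sub>2 \<subseteq> W\<^sub>1 \<union> W\<^sub>2"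
      using B by blast
  next
    fix e assume e: "e \<in> R\<^sub>1 \<union> R\<^sub>2"
    then show "dipath E (?P e)" "hd (?P e) = fst e" "last (?P e) = snd e" "set (?P e) \<subseteq> W\<^sub>1 \<union> W\<^sub>2"
      using 1(1)[of e] 2(1)[of e] by (cases "e \<in> R\<^sub>1"; simp; blast)+
    show "?I ?P e \<inter> (B\<^sub>1 \<union> B\<^sub>2) = {}"
    proof (cases "e \<in> R\<^sub>1")
      case True
      with 1(2)[of e] I1[of e] B show ?thesis by auto
    next
      case False
      with 2(2)[of e] I2[of e] B e show ?thesis by auto
    qed
  next
    fix e e' assume "e \<in> R\<^sub>1 \<union> R\<^sub>2" "e' \<in> R\<^sub>1 \<union> R\<^sub>2" "e \<noteq> e'"
    then show "?I ?P e \<inter> ?I ?P e' = {}"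
      using 11[of e e'] 12[of e e'] 12[of e' e] 22[of e e'] by (cases "e \<in> R\<^sub>1"; cases "e' \<in> R\<^sub>1") auto
  qed
qed

text \<open>The word \<open>es\<close> is an orientation pattern along the vertex sequence: in each
  entry the first flag stands for the forward arc and the second for the backward arc. Vertices may
  repeat, so closed sequences are covered.\<close>

fun links :: "'a list \<Rightarrow> (bool \<times> bool) list \<Rightarrow> 'a rel" where
  "links (a # b # ws) (e # es) =
     (if fst e then {(a, b)} else {}) \<union> (if snd e then {(b, a)} else {}) \<union> links (b # ws) es"
| "links _ _ = {}"

abbreviation digon :: "bool \<times> bool \<Rightarrow> bool" where
  "digon e \<equiv> fst e \<and> snd e"

lemma links_Cons:
  "ws \<noteq> [] \<Longrightarrow> links (a # ws) (e # es) = links [a, hd ws] [e] \<union> links ws es"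
  by (cases ws) auto

lemma links_map: "map_prod g g ` links vs es = links (map g vs) es"
  by (induction vs es rule: links.induct) (auto simp: image_Un)

text \<open>Only one flag is set, so a path between \<open>A\<close> and \<open>B\<close> in the
  right direction suffices. \<open>U\<close> is its vertex set; it leaves all of \<open>A\<close>
  and \<open>B\<close> except one vertex each to the neighbouring pieces.\<close>

lemma realise_single:
  assumes "strong E W" "A \<subseteq> W" "B \<subseteq> W" "A \<noteq> {}" "B \<noteq> {}" "\<not> digon e" "fst e \<or> snd e"
  obtains a b U P where "a \<in> A" "b \<in> B" "U \<subseteq> W" "U \<inter> A = {a}" "U \<inter> B = {b}"
    "realises E U {a, b} (links [a, b] [e]) P"
proof (cases "fst e")
  case True
  obtain xs where "dipath E xs" "set xs \<subseteq> W" "set xs \<inter> A = {hd xs}" "set xs \<inter> B = {last xs}"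
    using strong_path[OF assms(1-5)] .
  moreover have "links [hd xs, last xs] [e] = {(hd xs, last xs)}"
    using True assms(6) by simp
  ultimately show thesis
    by (intro that[of "hd xs" "last xs" "set xs" "\<lambda>_. xs"]) (auto simp: realises_def)
next
  case False
  obtain xs where "dipath E xs" "set xs \<subseteq> W" "set xs \<inter> B = {hd xs}" "set xs \<inter> A = {last xs}"
    using strong_path[OF assms(1,3,2,5,4)] .
  moreover have "links [last xs, hd xs] [e] = {(hd xs, last xs)}"
    using False assms(7) by simp
  ultimately show thesis
    by (intro that[of "last xs" "hd xs" "set xs" "\<lambda>_. xs"]) (auto simp: realises_def)
qed

text \<open>Two vertices cut the cycle into two paths that share only their ends. In contrast to a
  single arc, all of \<open>K\<close> is used up.\<close>

lemma realise_digon: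
  assumes "dicycle E K" "a \<in> K" "b \<in> K" "a \<noteq> b"
  obtains P where "realises E K {a, b} {(a, b), (b, a)} P"
proof -
  obtain xs where xs: "dipath E (a # xs)" "(last (a # xs), a) \<in> E" "set (a # xs) = K"
    using dicycle_rotate[OF assms(1,2)] .
  then obtain ys zs where split: "xs = ys @ b # zs"
    using assms(3,4) by (auto simp: in_set_conv_decomp)
  let ?p = "a # ys @ [b]" and ?q = "b # zs @ [a]"
  have "dipath E ?p"
    using xs(1) unfolding split by (auto simp: dipath_def successively_append_iff successively_Cons hd_append)
  moreover have "dipath E ?q"
    using xs(1,2) unfolding split
    by (cases zs rule: rev_cases)
      (auto simp: dipath_def successively_append_iff successively_Cons hd_append)
  moreover have "set ?p \<union> set ?q = K"
    using xs(3) split by auto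
  moreover have "set ?p \<inter> set ?q = {a, b}"
    using xs(1) unfolding split dipath_def by auto
  ultimately have "realises E K {a, b} {(a, b), (b, a)} (\<lambda>e. if e = (a, b) then ?p else ?q)"
    using xs(1) assms(4) unfolding realises_def split dipath_def by auto
  then show thesis
    by (rule that)
qed

section \<open>Chains of cycles\<close>

text \<open>The list runs towards the root: its last cycle is the only one that contains
  \<open>x\<close>, and only consecutive cycles meet.\<close>

inductive chain :: "'a rel \<Rightarrow> 'a \<Rightarrow> 'a set list \<Rightarrow> bool" for E x where
  root: "dicycle E K \<Longrightarrow> x \<in> K \<Longrightarrow> chain E x [K]"
| push: "chain E x (L # Ls) \<Longrightarrow> dicycle E K \<Longrightarrow> x \<notin> K \<Longrightarrow> K \<inter> L \<noteq> {} \<Longrightarrow> K \<inter> \<Union>(set Ls) = {} \<Longrightarrow>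
    chain E x (K # L # Ls)"

lemma chain_ConsD:
  assumes "chain E x (K # L # Ls)"
  shows "chain E x (L # Ls)" "dicycle E K" "x \<notin> K" "K \<inter> L \<noteq> {}" "K \<inter> \<Union>(set Ls) = {}"
  using assms by (cases rule: chain.cases, simp_all)+

text \<open>Consecutive cycles meet, so strong connectivity spreads along the chain. Hence one path
  can cross several cycles at once.\<close>

lemma chain_strong: "chain E x Ks \<Longrightarrow> strong E (\<Union>(set Ks))"
proof (induction rule: chain.induct)
  case (root K)
  then show ?case by (simp add: dicycle_strong)
next
  case (push L Ls K)
  have "strong E (K \<union> \<Union>(set (L # Ls)))"
    using push.hyps(4) by (intro strong_Un dicycle_strong push.hyps(2) push.IH) auto
  then show ?case
    by simp
qed

lemma chain_root: "chain E x Ks \<Longrightarrow> x \<in> \<Union>(set Ks)"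
  by (induction rule: chain.induct) auto

text \<open>
  A digon needs its whole cycle, so the set \<open>A\<close> of possible starting points must then be a singleton;
  a single arc can be started anywhere in \<open>A\<close> and leaves \<open>A\<close> at once.
\<close>

lemma chain_realise:
  assumes "chain E x (L # Ls)" "es \<noteq> []" "length es \<le> length (L # Ls)"
    and "\<forall>e \<in> set es. fst e \<or> snd e" "successively (\<lambda>e e'. \<not> (digon e \<and> digon e')) es"
    and "\<not> digon (last es)"
    and "A \<subseteq> L" "A \<noteq> {}" "A \<inter> \<Union>(set Ls) = {}" "x \<notin> A" "digon (hd es) \<longrightarrow> is_singleton A"
  shows "\<exists>ws P W. length ws = Suc (length es) \<and> distinct ws \<and> hd ws \<in> A \<and> last ws = x \<and>
    W \<subseteq> \<Union>(set (L # Ls)) \<and> W \<inter> A = {hd ws} \<and> realises E W (set ws) (links ws es) P"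
  using assms
proof (induction es arbitrary: L Ls A)
  case Nil
  then show ?case by simp
next
  case (Cons e es)
  show ?case
  proof (cases "es = []")
    case True
    \<comment> \<open>The last entry is a single arc; its path runs to \<open>x\<close> through all
      remaining cycles, however many there are.\<close>
    let ?W = "\<Union>(set (L # Ls))"
    have W: "{x} \<subseteq> ?W" "A \<subseteq> ?W"
      using chain_root[OF Cons.prems(1)] Cons.prems(7) by (simp, force)
    have e: "\<not> digon e" "fst e \<or> snd e"
      using Cons.prems(4,6) True by simp_all
    obtain a b U P where U: "a \<in> A" "b \<in> {x}" "U \<subseteq> ?W" "U \<inter> A = {a}"
        "realises E U {a, b} (links [a, b] [e]) P"
      using realise_single[OF chain_strong[OF Cons.prems(1)] W(2,1) Cons.prems(8) insert_not_empty e] .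
    have "a \<noteq> x"
      using U(1) Cons.prems(10) by blast
    with U show ?thesis
      by (intro exI[of _ "[a, x]"] exI[of _ P] exI[of _ U]) (simp add: True del: links.simps)
  next
    case False
    then obtain L' Ls' where Ls: "Ls = L' # Ls'"
      using Cons.prems(3) by (cases Ls) auto
    have chain: "chain E x (L' # Ls')" and L: "dicycle E L" "x \<notin> L" "L \<inter> L' \<noteq> {}" "L \<inter> \<Union>(set Ls') = {}"
      using chain_ConsD[OF Cons.prems(1)[unfolded Ls]] by simp_all
    have es: "length es \<le> length (L' # Ls')" "\<forall>e \<in> set es. fst e \<or> snd e"
        "successively (\<lambda>e e'. \<not> (digon e \<and> digon e')) es" "\<not> digon (last es)" "digon e \<Longrightarrow> \<not> digon (hd es)"
      using Cons.prems False unfolding Ls by (auto simp: successively_Cons)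
    \<comment> \<open>\<open>L\<close> meets the rest of the chain only in \<open>L'\<close>, so
      suitable parts of \<open>L \<inter> L'\<close> can serve as the next starting set.\<close>
    have IH: "\<exists>ws P W. length ws = Suc (length es) \<and> distinct ws \<and> hd ws \<in> A' \<and> last ws = x \<and>
        W \<subseteq> \<Union>(set (L' # Ls')) \<and> W \<inter> A' = {hd ws} \<and> realises E W (set ws) (links ws es) P"
      if "A' \<subseteq> L \<inter> L'" "A' \<noteq> {}" "digon (hd es) \<longrightarrow> is_singleton A'" for A'
    proof (rule Cons.IH[OF chain False es(1-4)])
      show "A' \<subseteq> L'" "A' \<inter> \<Union>(set Ls') = {}" "x \<notin> A'"
        using that(1) L(2,4) by blast+
    qed (use that in auto)
    \<comment> \<open>Both cases yield a piece \<open>U\<close> inside \<open>L\<close> that meets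
      the realisation of the remaining entries at most in the junction \<open>b\<close>. They differ
      in which of the two is built first.\<close>
    obtain a b U P ws P' W where U: "a \<in> A" "U \<subseteq> L" "U \<inter> A = {a}" "U \<inter> W \<subseteq> {b}"
        "realises E U {a, b} (links [a, b] [e]) P"
      and W: "length ws = Suc (length es)" "distinct ws" "hd ws = b" "last ws = x"
        "W \<subseteq> \<Union>(set (L' # Ls'))" "realises E W (set ws) (links ws es) P'"
    proof (cases "digon e")
      case True
      \<comment> \<open>The digon will occupy all of \<open>L\<close>, so the tail is built first.
        Its first entry is single, so it may start anywhere in \<open>L \<inter> L'\<close> and
        meets this set only once.\<close>
      have "digon (hd es) \<longrightarrow> is_singleton (L \<inter> L')"
        using es(5)[OF True] by blast
      from IH[OF order_refl L(3) this]
      obtain ws P' W where W: "length ws = Suc (length es)" "distinct ws" "hd ws \<in> L \<inter> L'" "last ws = x"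
          "W \<subseteq> \<Union>(set (L' # Ls'))" "W \<inter> (L \<inter> L') = {hd ws}" "realises E W (set ws) (links ws es) P'"
        by (elim exE conjE)
      have "is_singleton A"
        using Cons.prems(11) True by simp
      then obtain a where A: "A = {a}"
        by (elim is_singletonE)
      have "a \<in> L" "hd ws \<in> L" "a \<noteq> hd ws"
        using Cons.prems(7,9) W(3) unfolding A Ls by auto
      then obtain P where "realises E L {a, hd ws} {(a, hd ws), (hd ws, a)} P"
        using realise_digon[OF L(1)] by blast
      moreover have "links [a, hd ws] [e] = {(a, hd ws), (hd ws, a)}"
        using True by auto
      moreover have "L \<inter> W \<subseteq> {hd ws}"
      proof
        fix z assume z: "z \<in> L \<inter> W"
        then have "z \<in> W \<inter> (L \<inter> L')"
          using W(5) L(4) by (simp; blast)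
        then show "z \<in> {hd ws}"
          unfolding W(6) .
      qed
      ultimately show thesis
        using A \<open>a \<in> L\<close> by (intro that[of a L W "hd ws" P ws P'] W(1,2,4,5,7)) simp_all
    next
      case nd: False
      \<comment> \<open>Here the path is built first, and it touches \<open>L \<inter> L'\<close>
        only at \<open>b\<close>. The tail then starts from the singleton \<open>{b}\<close>, so its
        first entry may be a digon.\<close>
      obtain a b U P where U: "a \<in> A" "b \<in> L \<inter> L'" "U \<subseteq> L" "U \<inter> A = {a}" "U \<inter> (L \<inter> L') = {b}"
          "realises E U {a, b} (links [a, b] [e]) P"
        using realise_single[OF dicycle_strong[OF L(1)] Cons.prems(7) Int_lower1 Cons.prems(8) L(3) nd]
          Cons.prems(4) by (metis list.set_intros(1))
      have "{b} \<subseteq> L \<inter> L'" "{b} \<noteq> {}" "digon (hd es) \<longrightarrow> is_singleton {b}"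
        using U(2) by auto
      from IH[OF this]
      obtain ws P' W where W: "length ws = Suc (length es)" "distinct ws" "hd ws \<in> {b}" "last ws = x"
          "W \<subseteq> \<Union>(set (L' # Ls'))" "W \<inter> {b} = {hd ws}" "realises E W (set ws) (links ws es) P'"
        by (elim exE conjE)
      have "U \<inter> W \<subseteq> {b}"
      proof
        fix z assume z: "z \<in> U \<inter> W"
        then have "z \<in> U \<inter> (L \<inter> L')"
          using W(5) L(4) U(3) by (simp; blast)
        then show "z \<in> {b}"
          unfolding U(5) .
      qed
      then show thesis
        using W(3) by (intro that[of a U W b P ws P'] U(1,3,4,6) W(1,2,4,5,7)) simp_all
    qed
    have ws: "ws \<noteq> []" "b \<in> set ws" "set ws \<subseteq> W"
      using W(1,3,6) by (cases ws; auto simp: realises_def)+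
    have "W \<inter> A = {}"
      using W(5) Cons.prems(9) unfolding Ls by auto
    then have "distinct (a # ws)" "(U \<union> W) \<inter> A = {a}"
      using W(2) ws U(1,3) by auto
    moreover have "realises E (U \<union> W) ({a, b} \<union> set ws) (links [a, b] [e] \<union> links ws es)
        (\<lambda>e'. if e' \<in> links [a, b] [e] then P e' else P' e')"
      using U(4,5) W(6) ws by (intro realises_Un) auto
    then have "realises E (U \<union> W) (set (a # ws)) (links (a # ws) (e # es))
        (\<lambda>e'. if e' \<in> links [a, b] [e] then P e' else P' e')"
      using links_Cons[OF ws(1), of a e es] ws(2) W(3) by (simp add: insert_absorb del: links.simps)
    moreover have "U \<union> W \<subseteq> \<Union>(set (L # Ls))"
      using U(2) W(5) unfolding Ls by auto
    ultimately show ?thesis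
      using W(1,4) ws(1) U(1) by (intro exI[of _ "a # ws"] exI[of _ "U \<union> W"] exI) (auto simp del: links.simps)
  qed
qed

text \<open>The cycle \<open>K\<close> closes the chain: it contains \<open>x\<close> and meets the
  far end \<open>L\<close>, so it can carry the digon between \<open>x\<close> and the first vertex
  of \<open>ws\<close>. As \<open>hd es\<close> is not a digon, the tail may start anywhere in
  \<open>K \<inter> L\<close> and meets this set only once.\<close>

lemma chain_realise_cycle:
  assumes "chain E x (L # Ls)" "Ls \<noteq> []" "dicycle E K" "x \<in> K" "K \<inter> L \<noteq> {}" "K \<inter> \<Union>(set Ls) \<subseteq> {x}"
    and "es \<noteq> []" "length es \<le> length (L # Ls)"
    and "\<forall>e \<in> set es. fst e \<or> snd e" "successively (\<lambda>e e'. \<not> (digon e \<and> digon e')) es"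
    and "\<not> digon (hd es)" "\<not> digon (last es)"
  obtains ws P W where "length ws = Suc (length es)" "distinct ws" "last ws = x"
    "W \<subseteq> K \<union> \<Union>(set (L # Ls))" "realises E W (set (x # ws)) (links (x # ws) ((True, True) # es)) P"
proof -
  have "x \<notin> L"
    using assms(1,2) chain_ConsD(3) by (metis neq_Nil_conv)
  then have "K \<inter> L \<inter> \<Union>(set Ls) = {}" "x \<notin> K \<inter> L" "digon (hd es) \<longrightarrow> is_singleton (K \<inter> L)"
    using assms(6,11) by blast+
  from chain_realise[OF assms(1,7-10,12) Int_lower2 assms(5) this]
  obtain ws P W where W: "length ws = Suc (length es)" "distinct ws" "hd ws \<in> K \<inter> L" "last ws = x"
      "W \<subseteq> \<Union>(set (L # Ls))" "W \<inter> (K \<inter> L) = {hd ws}" "realises E W (set ws) (links ws es) P"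
    by (elim exE conjE)
  have ne: "ws \<noteq> []"
    using W(1) by auto
  have "hd ws \<noteq> x"
    using \<open>x \<notin> L\<close> W(3) by blast
  then obtain P' where P': "realises E K {x, hd ws} {(x, hd ws), (hd ws, x)} P'"
    using realise_digon[OF assms(3,4), of "hd ws"] W(3) by auto
  have sub: "x \<in> set ws" "hd ws \<in> set ws"
    using ne W(4) last_in_set[of ws] by auto
  have "K \<inter> W \<subseteq> {x, hd ws}"
  proof
    fix z assume z: "z \<in> K \<inter> W"
    then have "z \<in> W \<inter> (K \<inter> L) \<or> z = x"
      using W(5) assms(6) by (simp; blast)
    then show "z \<in> {x, hd ws}"
      unfolding W(6) by blast
  qed
  then have "realises E (K \<union> W) ({x, hd ws} \<union> set ws) ({(x, hd ws), (hd ws, x)} \<union> links ws es)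
      (\<lambda>e. if e \<in> {(x, hd ws), (hd ws, x)} then P' e else P e)"
    using P' W(7) sub by (intro realises_Un) auto
  moreover have "{x, hd ws} \<union> set ws = set (x # ws)"
    using sub by auto
  moreover have "{(x, hd ws), (hd ws, x)} \<union> links ws es = links (x # ws) ((True, True) # es)"
    using links_Cons[OF ne, of x "(True, True)" es] by auto
  ultimately show thesis
    using W(5) by (intro that[OF W(1,2,4), of "K \<union> W"]) (auto simp del: links.simps)
qed

section \<open>Shifting colours along cycles\<close>

definition colouring :: "'a rel \<Rightarrow> 'a set \<Rightarrow> nat \<Rightarrow> ('a \<Rightarrow> nat) \<Rightarrow> bool" where
  "colouring E A k c \<longleftrightarrow> c ` A \<subseteq> {1..k} \<and>
     (\<forall>i \<in> {1..k}. \<forall>K. dicycle E K \<longrightarrow> \<not> K \<subseteq> {v \<in> A. c v = i})"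

locale shift =
  fixes E :: "'a rel" and V :: "'a set" and x :: 'a and k :: nat and c :: "'a \<Rightarrow> nat"
  assumes finite_V: "finite V" and x_notin: "x \<notin> V" and loopless: "(x, x) \<notin> E"
    and k_pos: "1 \<le> k" and c_colouring: "colouring E V k c"
begin

definition cls :: "nat \<Rightarrow> 'a set" where
  "cls i = {v \<in> V. c v = i}"

text \<open>Pushing lowers a colour cyclically by one, so \<open>nxt j\<close> is the old colour of
  the pushed vertices whose new colour is \<open>j\<close>. The new class \<open>j\<close> thus
  consists of the pushed part of \<open>cls (nxt j)\<close> and the unpushed part of
  \<open>cls j\<close>, together with \<open>x\<close> if \<open>j = k\<close>. The rules of
  \<open>pushes\<close> pick cycles inside such classes.\<close>

definition nxt :: "nat \<Rightarrow> nat" where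
  "nxt j = (if j = k then 1 else Suc j)"

definition pushed :: "'a set list \<Rightarrow> 'a set" where
  "pushed Ks = \<Union>(set Ks) - {x}"

text \<open>The head of the list is the cycle that was used last.\<close>

inductive pushes :: "'a set list \<Rightarrow> bool" where
  Nil: "pushes []"
| root: "pushes Ks \<Longrightarrow> dicycle E K \<Longrightarrow> x \<in> K \<Longrightarrow> K \<subseteq> insert x (cls k - pushed Ks) \<Longrightarrow> pushes (K # Ks)"
| push: "pushes Ks \<Longrightarrow> dicycle E K \<Longrightarrow> x \<notin> K \<Longrightarrow> j \<in> {1..k} \<Longrightarrow>
    K \<subseteq> (pushed Ks \<inter> cls (nxt j)) \<union> (cls j - pushed Ks) \<Longrightarrow> K \<inter> (cls j - pushed Ks) \<noteq> {} \<Longrightarrow>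
    pushes (K # Ks)"

lemma nxt_in: "j \<in> {1..k} \<Longrightarrow> nxt j \<in> {1..k}"
  using k_pos by (auto simp: nxt_def)

lemma cls_subset: "cls i \<subseteq> V"
  by (auto simp: cls_def)

lemma no_dicycle_cls: "i \<in> {1..k} \<Longrightarrow> dicycle E K \<Longrightarrow> \<not> K \<subseteq> cls i"
  using c_colouring by (auto simp: colouring_def cls_def)

lemma pushed_Cons: "pushed (K # Ks) = (K - {x}) \<union> pushed Ks"
  by (auto simp: pushed_def)

lemma Union_subset_pushed: "\<Union>(set Ks) \<subseteq> insert x (pushed Ks)"
  by (auto simp: pushed_def)

lemma pushes_pushed_subset: "pushes Ks \<Longrightarrow> pushed Ks \<subseteq> V"
proof (induction rule: pushes.induct)
  case Nil
  then show ?case by (simp add: pushed_def)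
next
  case (root Ks K)
  then show ?case
    using cls_subset[of k] unfolding pushed_Cons by blast
next
  case (push Ks K j)
  then show ?case
    using cls_subset[of j] unfolding pushed_Cons by blast
qed

text \<open>Every cycle pushes a new vertex; in rule \<open>root\<close> this holds because the
  absence of a loop at \<open>x\<close> gives the cycle a second vertex. Hence the shift must
  stop.\<close>

lemma pushes_length: "pushes Ks \<Longrightarrow> length Ks \<le> card (pushed Ks)"
proof (induction rule: pushes.induct)
  case Nil
  then show ?case by simp
next
  case (root Ks K)
  have "finite (pushed (K # Ks))"
    using pushes_pushed_subset[OF pushes.root[OF root.hyps]] finite_V finite_subset by blast
  moreover have "pushed Ks \<subset> pushed (K # Ks)"
    using dicycle_singleton[OF root.hyps(2), of x] loopless root.hyps(4) unfolding pushed_Cons by blast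
  ultimately have "card (pushed Ks) < card (pushed (K # Ks))"
    by (rule psubset_card_mono)
  then show ?case
    using root.IH by simp
next
  case (push Ks K j)
  have "finite (pushed (K # Ks))"
    using pushes_pushed_subset[OF pushes.push[OF push.hyps]] finite_V finite_subset by blast
  moreover have "pushed Ks \<subset> pushed (K # Ks)"
    using push.hyps(3,6) unfolding pushed_Cons by blast
  ultimately have "card (pushed Ks) < card (pushed (K # Ks))"
    by (rule psubset_card_mono)
  then show ?case
    using push.IH by simp
qed

text \<open>
  Every pushed vertex hangs on a chain of cycles rooted at \<^term>\<open>x\<close>: go from a cycle to the oldest
  cycle that it meets. Starting from a set \<open>A\<close>, the oldest choice keeps the later part of the chain away
  from \<open>A\<close>. Colours decrease by one modulo \<open>k\<close> in each step, which determines the length modulo \<open>k\<close>.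
\<close>

lemma pushes_chain:
  assumes "pushes Ks" "A \<noteq> {}" "A \<subseteq> pushed Ks" "A \<subseteq> cls i" "i \<in> {1..k}"
  shows "\<exists>L Ls. chain E x (L # Ls) \<and> set (L # Ls) \<subseteq> set Ks \<and> L \<inter> A \<noteq> {} \<and> A \<inter> \<Union>(set Ls) = {} \<and>
    (\<exists>q. length (L # Ls) + i = q * k + 1)"
  using assms
proof (induction arbitrary: A i rule: pushes.induct)
  case Nil
  then show ?case by (simp add: pushed_def)
next
  case (root Ks K)
  show ?case
  proof (cases "A \<inter> pushed Ks = {}")
    case False
    \<comment> \<open>Some vertex of \<open>A\<close> was pushed before \<open>K\<close>, so the
      oldest cycle meeting \<open>A\<close> already belongs to \<open>Ks\<close>.\<close>
    have "A \<inter> pushed Ks \<subseteq> cls i"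
      using root.prems(3) by blast
    from root.IH[OF False Int_lower2 this root.prems(4)]
    obtain L Ls where L: "chain E x (L # Ls)" "set (L # Ls) \<subseteq> set Ks" "L \<inter> (A \<inter> pushed Ks) \<noteq> {}"
        "A \<inter> pushed Ks \<inter> \<Union>(set Ls) = {}" and q: "\<exists>q. length (L # Ls) + i = q * k + 1"
      by (elim exE conjE) blast
    have "x \<notin> A"
      using root.prems(2) by (auto simp: pushed_def)
    then have "A \<inter> \<Union>(set Ls) \<subseteq> A \<inter> pushed Ks \<inter> \<Union>(set Ls)"
      using L(2) by (auto simp: pushed_def)
    with L q show ?thesis
      by (intro exI[of _ L] exI[of _ Ls]) auto
  next
    case True
    then have "A \<subseteq> K"
      using root.prems(2) unfolding pushed_Cons by blast
    have "i = k"
      using root.prems(1-3) \<open>A \<subseteq> K\<close> root.hyps(4) by (auto simp: cls_def pushed_def)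
    then have "length [K] + i = 1 * k + 1"
      by simp
    then have "\<exists>q. length [K] + i = q * k + 1"
      by blast
    then show ?thesis
      using chain.root[OF root.hyps(2,3)] root.prems(1) \<open>A \<subseteq> K\<close>
      by (intro exI[of _ K] exI[of _ "[]"]) auto
  qed
next
  case (push Ks K j)
  show ?case
  proof (cases "A \<inter> pushed Ks = {}")
    case False
    have "A \<inter> pushed Ks \<subseteq> cls i"
      using push.prems(3) by blast
    from push.IH[OF False Int_lower2 this push.prems(4)]
    obtain L Ls where L: "chain E x (L # Ls)" "set (L # Ls) \<subseteq> set Ks" "L \<inter> (A \<inter> pushed Ks) \<noteq> {}"
        "A \<inter> pushed Ks \<inter> \<Union>(set Ls) = {}" and q: "\<exists>q. length (L # Ls) + i = q * k + 1"
      by (elim exE conjE) blast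
    have "x \<notin> A"
      using push.prems(2) by (auto simp: pushed_def)
    then have "A \<inter> \<Union>(set Ls) \<subseteq> A \<inter> pushed Ks \<inter> \<Union>(set Ls)"
      using L(2) by (auto simp: pushed_def)
    with L q show ?thesis
      by (intro exI[of _ L] exI[of _ Ls]) auto
  next
    case True
    then have "A \<subseteq> K"
      using push.prems(2) unfolding pushed_Cons by blast
    then have "i = j"
      using push.prems(1,3) True push.hyps(5) by (auto simp: cls_def)
    \<comment> \<open>The trace continues from the vertices of \<open>K\<close> that were already
      pushed. They exist, since otherwise \<open>K\<close> would lie in the single original class
      \<open>cls j\<close>; their original colour is \<open>nxt j\<close>.\<close>
    let ?B = "K \<inter> pushed Ks"
    have B: "?B \<noteq> {}"
      using no_dicycle_cls[OF push.hyps(4,2)] push.hyps(5) by blast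
    have "?B \<subseteq> cls (nxt j)"
      using push.hyps(5) by blast
    from push.IH[OF B Int_lower2 this nxt_in[OF push.hyps(4)]]
    obtain L Ls q where L: "chain E x (L # Ls)" "set (L # Ls) \<subseteq> set Ks" "L \<inter> ?B \<noteq> {}"
        "?B \<inter> \<Union>(set Ls) = {}" and q: "length (L # Ls) + nxt j = q * k + 1"
      by (elim exE conjE)
    have sub: "\<Union>(set (L # Ls)) \<subseteq> insert x (pushed Ks)"
      using L(2) Union_subset_pushed[of Ks] by blast
    then have "K \<inter> \<Union>(set Ls) = {}"
      using L(4) push.hyps(3) by auto
    then have chain: "chain E x (K # L # Ls)"
      using L(1,3) push.hyps(2,3) by (intro chain.push) auto
    have "x \<notin> A"
      using push.prems(2) by (auto simp: pushed_def)
    then have "A \<inter> \<Union>(set (L # Ls)) = {}"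
      using sub True by blast
    \<comment> \<open>One more cycle makes up for the step from \<open>nxt j\<close> down to
      \<open>j\<close>; wrapping around from \<open>1\<close> to \<open>k\<close> raises
      \<open>q\<close> by one.\<close>
    moreover have "\<exists>q. length (K # L # Ls) + i = q * k + 1"
    proof (cases "j = k")
      case True
      then have "length (K # L # Ls) + i = (q + 1) * k + 1"
        using q \<open>i = j\<close> by (simp add: nxt_def)
      then show ?thesis by blast
    next
      case False
      then have "length (K # L # Ls) + i = q * k + 1"
        using q \<open>i = j\<close> by (simp add: nxt_def)
      then show ?thesis by blast
    qed
    moreover have "set (K # L # Ls) \<subseteq> set (K # Ks)"
      using L(2) by auto
    ultimately show ?thesis
      using chain push.prems(1) \<open>A \<subseteq> K\<close> by (intro exI[of _ K] exI[of _ "L # Ls"]) auto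
  qed
qed

section \<open>Where the shift gets stuck\<close>

lemma ex_maximal_pushes: "\<exists>Ks. pushes Ks \<and> (\<forall>K. \<not> pushes (K # Ks))"
proof -
  have "length Ks \<le> card V" if "pushes Ks" for Ks
    using pushes_length[OF that] card_mono[OF finite_V pushes_pushed_subset[OF that]] by simp
  then have "\<exists>Ks. pushes Ks \<and> (\<forall>Ls. pushes Ls \<longrightarrow> length Ls \<le> length Ks)"
    using pushes.Nil by (intro ex_has_greatest_nat[where b = "Suc (card V)"]) (auto simp: less_Suc_eq_le)
  then obtain Ks where Ks: "pushes Ks" "\<forall>Ls. pushes Ls \<longrightarrow> length Ls \<le> length Ks"
    by blast
  have "\<not> pushes (K # Ks)" for K
    using Ks(2) by (metis Suc_n_not_le_n length_Cons)
  with Ks(1) show ?thesis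
    by blast
qed

text \<open>The hypothesis is applied to the colouring that results from a maximal sequence of
  pushes. A directed cycle in a new class contains \<open>x\<close> and a pushed vertex: otherwise
  it would allow a further push or lie in one class of \<open>c\<close>.\<close>

lemma ex_closing_cycle:
  assumes "\<And>c'. \<not> colouring E (insert x V) k c'"
  obtains Ks K where "pushes Ks" "dicycle E K" "x \<in> K" "K \<subseteq> insert x V" "K \<inter> pushed Ks \<noteq> {}"
    "K \<inter> pushed Ks \<subseteq> cls 1"
proof -
  obtain Ks where Ks: "pushes Ks" and max: "\<And>K. \<not> pushes (K # Ks)"
    using ex_maximal_pushes by blast
  have sub: "pushed Ks \<subseteq> V"
    by (rule pushes_pushed_subset[OF Ks])
  have c: "c v \<in> {1..k}" if "v \<in> V" for v
    using c_colouring that by (auto simp: colouring_def)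
  \<comment> \<open>The shifted colouring: pushed vertices move to the next lower colour,
    cyclically, and \<open>x\<close> has colour \<open>k\<close>.\<close>
  define c' where "c' v = (if v = x then k else if v \<notin> pushed Ks then c v
    else if c v = 1 then k else c v - 1)" for v
  have "c' v \<in> {1..k}" if "v \<in> insert x V" for v
    using that c[of v] k_pos by (auto simp: c'_def)
  then have "c' ` insert x V \<subseteq> {1..k}"
    by blast
  with assms[of c'] obtain j K where j: "j \<in> {1..k}" and K: "dicycle E K" "K \<subseteq> {v \<in> insert x V. c' v = j}"
    by (auto simp: colouring_def)
  have new: "v \<in> (pushed Ks \<inter> cls (nxt j)) \<union> (cls j - pushed Ks)" if "v \<in> K" "v \<noteq> x" for v
  proof -
    have v: "v \<in> V" "c' v = j"
      using K(2) that by auto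
    then show ?thesis
      using c[OF v(1)] j that(2) by (auto simp: c'_def cls_def nxt_def split: if_splits)
  qed
  have "x \<in> K"
  proof (rule ccontr)
    assume "x \<notin> K"
    then have *: "K \<subseteq> (pushed Ks \<inter> cls (nxt j)) \<union> (cls j - pushed Ks)"
      using new by blast
    then have "K \<inter> (cls j - pushed Ks) \<noteq> {}"
      using no_dicycle_cls[OF nxt_in[OF j] K(1)] by blast
    with pushes.push[OF Ks K(1) \<open>x \<notin> K\<close> j *] max show False
      by blast
  qed
  then have "j = k"
    using K(2) by (auto simp: c'_def)
  \<comment> \<open>As \<open>nxt k = 1\<close>, the pushed vertices on \<open>K\<close> had the
    original colour \<open>1\<close>.\<close>
  then have *: "K \<subseteq> insert x ((pushed Ks \<inter> cls 1) \<union> (cls k - pushed Ks))"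
    using new by (auto simp: nxt_def)
  have "K \<inter> pushed Ks \<noteq> {}"
  proof
    assume "K \<inter> pushed Ks = {}"
    with * have "K \<subseteq> insert x (cls k - pushed Ks)"
      by blast
    with pushes.root[OF Ks K(1) \<open>x \<in> K\<close>] max show False
      by blast
  qed
  moreover have "K \<inter> pushed Ks \<subseteq> cls 1"
    using * x_notin sub by blast
  moreover have "K \<subseteq> insert x V"
    using K(2) by blast
  ultimately show thesis
    using that[OF Ks K(1) \<open>x \<in> K\<close>] by blast
qed

lemma realise_cycle:
  assumes "2 \<le> k" "\<And>c'. \<not> colouring E (insert x V) k c'"
    and "length es = k" "\<forall>e \<in> set es. fst e \<or> snd e"
    and "successively (\<lambda>e e'. \<not> (digon e \<and> digon e')) es" "\<not> digon (hd es)" "\<not> digon (last es)"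
  obtains ws P W where "length ws = Suc k" "distinct ws" "last ws = x" "W \<subseteq> insert x V"
    "realises E W (set (x # ws)) (links (x # ws) ((True, True) # es)) P"
proof -
  obtain Ks K where Ks: "pushes Ks" and K: "dicycle E K" "x \<in> K" "K \<subseteq> insert x V" "K \<inter> pushed Ks \<noteq> {}"
      "K \<inter> pushed Ks \<subseteq> cls 1"
    using ex_closing_cycle[OF assms(2)] .
  \<comment> \<open>The trace starts at colour \<open>i = 1\<close>, so the length of the chain is a
    multiple of \<open>k\<close>. Being positive, it is at least \<open>k\<close>, which provides a
    cycle for each entry of \<open>es\<close>.\<close>
  obtain L Ls q where L: "chain E x (L # Ls)" "set (L # Ls) \<subseteq> set Ks" "L \<inter> (K \<inter> pushed Ks) \<noteq> {}"
      "K \<inter> pushed Ks \<inter> \<Union>(set Ls) = {}" and q: "length (L # Ls) + 1 = q * k + 1"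
    using pushes_chain[OF Ks K(4) Int_lower2 K(5)] k_pos by (auto simp del: length_Cons)
  have sub: "\<Union>(set (L # Ls)) \<subseteq> insert x (pushed Ks)"
    using L(2) Union_subset_pushed[of Ks] by blast
  have "q \<noteq> 0"
    using q by (intro notI) simp
  then have len: "k \<le> length (L # Ls)"
    using q by (cases q) simp_all
  then have "Ls \<noteq> []" "es \<noteq> []" "length es \<le> length (L # Ls)"
    using assms(1,3) by auto
  moreover have "K \<inter> L \<noteq> {}" "K \<inter> \<Union>(set Ls) \<subseteq> {x}"
    using L(3,4) sub by auto
  ultimately obtain ws P W where W: "length ws = Suc (length es)" "distinct ws" "last ws = x"
      "W \<subseteq> K \<union> \<Union>(set (L # Ls))" "realises E W (set (x # ws)) (links (x # ws) ((True, True) # es)) P"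
    using chain_realise_cycle[OF L(1) _ K(1,2) _ _ _ _ assms(4-7)] by metis
  have "W \<subseteq> insert x V"
    using W(4) sub K(3) pushes_pushed_subset[OF Ks] by blast
  then show thesis
    using W assms(3) by (intro that) simp_all
qed

text \<open>For the case \<open>k = 1\<close>, where one cycle through \<open>x\<close> replaces the
  chain.\<close>

lemma ex_dicycle_through:
  assumes "\<And>c'. \<not> colouring E (insert x V) k c'"
  obtains K where "dicycle E K" "x \<in> K" "K \<subseteq> insert x V"
  by (rule ex_closing_cycle[OF assms])

end

section \<open>Arc walks as vertex lists\<close>

text \<open>Walks in the library are arc lists. This passes from vertex lists to them, and
  \<open>pawalk_verts\<close> leads back.\<close>

definition arcs_along :: "'a list \<Rightarrow> ('a \<times> 'a) list" where
  "arcs_along xs = zip xs (tl xs)"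

lemma arcs_along_Cons_Cons [simp]: "arcs_along (a # b # xs) = (a, b) # arcs_along (b # xs)"
  by (simp add: arcs_along_def)

lemma arcs_along_single [simp]: "arcs_along [a] = []"
  by (simp add: arcs_along_def)

lemma arcs_along_walk:
  assumes "xs \<noteq> []" "successively (\<lambda>a b. (a, b) \<in> E) xs"
  shows "pcas (hd xs) (arcs_along xs) (last xs)" "pawalk_verts (hd xs) (arcs_along xs) = xs"
    "set (arcs_along xs) \<subseteq> E" "set (arcs_along xs) \<subseteq> set xs \<times> set xs"
proof -
  have "pcas (hd xs) (arcs_along xs) (last xs) \<and> pawalk_verts (hd xs) (arcs_along xs) = xs \<and>
    set (arcs_along xs) \<subseteq> E \<and> set (arcs_along xs) \<subseteq> set xs \<times> set xs"
    using assms
  proof (induction xs rule: induct_list012)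
    case (3 a b xs)
    then have "(a, b) \<in> E" "pcas b (arcs_along (b # xs)) (last (b # xs))"
        "pawalk_verts b (arcs_along (b # xs)) = b # xs" "set (arcs_along (b # xs)) \<subseteq> E"
        "set (arcs_along (b # xs)) \<subseteq> set (b # xs) \<times> set (b # xs)"
      by simp_all
    moreover from this(5) have "set (arcs_along (b # xs)) \<subseteq> set (a # b # xs) \<times> set (a # b # xs)"
      by auto
    ultimately show ?case
      by simp
  qed simp_all
  then show "pcas (hd xs) (arcs_along xs) (last xs)" "pawalk_verts (hd xs) (arcs_along xs) = xs"
    "set (arcs_along xs) \<subseteq> E" "set (arcs_along xs) \<subseteq> set xs \<times> set xs"
    by blast+
qed

lemma pawalk_verts_walk:
  assumes "pcas u p v" "set p \<subseteq> E"
  shows "pawalk_verts u p \<noteq> []" "hd (pawalk_verts u p) = u" "last (pawalk_verts u p) = v"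
    "successively (\<lambda>a b. (a, b) \<in> E) (pawalk_verts u p)"
proof -
  have "pawalk_verts u p \<noteq> [] \<and> hd (pawalk_verts u p) = u \<and> last (pawalk_verts u p) = v \<and>
    successively (\<lambda>a b. (a, b) \<in> E) (pawalk_verts u p)"
    using assms
  proof (induction p arbitrary: u)
    case (Cons e p)
    then have "(u, snd e) \<in> E" "pcas (snd e) p v" "set p \<subseteq> E"
      by (cases e, auto)+
    then show ?case
      using Cons.IH[of "snd e"] Cons.prems(1) by (simp add: successively_Cons)
  qed simp
  then show "pawalk_verts u p \<noteq> []" "hd (pawalk_verts u p) = u" "last (pawalk_verts u p) = v"
    "successively (\<lambda>a b. (a, b) \<in> E) (pawalk_verts u p)"
    by blast+
qed

text \<open>A library cycle based at \<open>u\<close> visits \<open>u\<close> first and last;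
  deleting the first visit leaves a duplicate-free vertex list whose closing arc is the first arc of
  the cycle. Conversely, the last vertex of such a list is put in front again.\<close>

lemma induced_cycle_iff:
  assumes "A \<subseteq> pverts D"
  shows "(\<exists>p. pre_digraph.cycle (with_proj D \<restriction> A) p) \<longleftrightarrow> (\<exists>K. dicycle (parcs D) K \<and> K \<subseteq> A)"
proof -
  define D' where "D' = \<lparr>pverts = A, parcs = {e \<in> parcs D. fst e \<in> A \<and> snd e \<in> A}\<rparr>"
  have D': "with_proj D \<restriction> A = with_proj D'"
    by (simp add: induce_subgraph_def with_proj_def D'_def)
  have cycle: "pre_digraph.cycle (with_proj D') p \<longleftrightarrow>
      (\<exists>u. u \<in> A \<and> set p \<subseteq> parcs D' \<and> pcas u p u \<and> distinct (tl (pawalk_verts u p)) \<and> p \<noteq> [])" for p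
    by (simp add: pre_digraph.cycle_def pre_digraph.awalk_def cas_with_proj_eq awalk_verts_with_proj_eq)
      (auto simp: D'_def)
  show ?thesis
    unfolding D'
  proof
    assume "\<exists>p. pre_digraph.cycle (with_proj D') p"
    then obtain u p where p: "set p \<subseteq> parcs D'" "pcas u p u" "distinct (tl (pawalk_verts u p))" "p \<noteq> []" "u \<in> A"
      unfolding cycle by blast
    note walk = pawalk_verts_walk[OF p(2,1)]
    then obtain zs where zs: "pawalk_verts u p = u # zs"
      by (cases "pawalk_verts u p") auto
    have "zs \<noteq> []"
      using zs p(4) by (cases p; cases "tl p") auto
    then have "successively (\<lambda>a b. (a, b) \<in> parcs D') zs" "last zs = u" "(u, hd zs) \<in> parcs D'"
      using walk(3,4) unfolding zs by (simp_all add: successively_Cons)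
    then have "dipath (parcs D') zs"
      using p(3) \<open>zs \<noteq> []\<close> unfolding zs dipath_def by simp
    then have "dipath (parcs D) zs"
      by (rule dipath_mono) (auto simp: D'_def)
    moreover have "(last zs, hd zs) \<in> parcs D"
      using \<open>last zs = u\<close> \<open>(u, hd zs) \<in> parcs D'\<close> by (simp add: D'_def)
    moreover have "set (pawalk_verts v q) \<subseteq> A" if "v \<in> A" "set q \<subseteq> parcs D'" for v q
      using that by (induction q arbitrary: v) (auto simp: D'_def)
    from this[OF p(5,1)] have "set zs \<subseteq> A"
      unfolding zs by simp
    ultimately show "\<exists>K. dicycle (parcs D) K \<and> K \<subseteq> A"
      unfolding dicycle_def by blast
  next
    assume "\<exists>K. dicycle (parcs D) K \<and> K \<subseteq> A"
    then obtain xs where xs: "dipath (parcs D) xs" "(last xs, hd xs) \<in> parcs D" "set xs \<subseteq> A"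
      by (auto simp: dicycle_def)
    let ?ys = "last xs # xs"
    have "successively (\<lambda>a b. (a, b) \<in> parcs D) ?ys"
      using xs(1,2) by (simp add: dipath_def successively_Cons)
    note walk = arcs_along_walk[OF _ this]
    have "last xs \<in> A"
      using xs(1,3) unfolding dipath_def by (meson last_in_set subsetD)
    then have "set ?ys \<subseteq> A"
      using xs(3) by simp
    then have "set (arcs_along ?ys) \<subseteq> A \<times> A"
      using walk(4)[OF list.distinct(2)] by (meson Sigma_mono subset_trans)
    then have "set (arcs_along ?ys) \<subseteq> parcs D'"
      using walk(3)[OF list.distinct(2)] unfolding D'_def by auto
    moreover have "pcas (last xs) (arcs_along ?ys) (last xs)" "pawalk_verts (last xs) (arcs_along ?ys) = ?ys"
      using walk(1,2)[OF list.distinct(2)] xs(1) unfolding dipath_def by simp_all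
    moreover have "arcs_along ?ys \<noteq> []"
      using xs(1) by (cases xs) (auto simp: dipath_def)
    ultimately show "\<exists>p. pre_digraph.cycle (with_proj D') p"
      unfolding cycle using xs(1) \<open>last xs \<in> A\<close>
      by (intro exI[of _ "arcs_along ?ys"] exI[of _ "last xs"]) (auto simp: dipath_def)
  qed
qed

section \<open>Acyclic colourings and the dichromatic number\<close>

lemma acyclic_colouring_iff: "acyclic_colouring D k c \<longleftrightarrow> colouring (parcs D) (pverts D) k c"
proof -
  have "(\<not> (\<exists>p. pre_digraph.cycle (with_proj D \<restriction> {x \<in> pverts D. c x = i}) p)) \<longleftrightarrow>
      (\<forall>K. dicycle (parcs D) K \<longrightarrow> \<not> K \<subseteq> {x \<in> pverts D. c x = i})" for i
    by (subst induced_cycle_iff) auto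
  then show ?thesis
    unfolding acyclic_colouring_def colouring_def by simp
qed

text \<open>All vertices get different colours, so a monochromatic cycle would be a loop. This
  ensures that the least number in \<open>dichromatic_number\<close> is attained.\<close>

lemma ex_colouring:
  assumes "finite A" "\<And>a. (a, a) \<notin> E"
  shows "\<exists>k c. colouring E A k c"
proof -
  obtain h where h: "bij_betw h A {0..<card A}"
    using ex_bij_betw_finite_nat[OF assms(1)] by blast
  have "colouring E A (card A) (\<lambda>a. Suc (h a))"
    unfolding colouring_def
  proof (intro conjI ballI allI impI notI)
    show "(\<lambda>a. Suc (h a)) ` A \<subseteq> {1..card A}"
      using bij_betwE[OF h] by (auto simp: Suc_le_eq)
  next
    fix i K assume K: "dicycle E K" "K \<subseteq> {v \<in> A. Suc (h v) = i}"
    then obtain a where "a \<in> K"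
      using dicycle_nonempty by blast
    then have "K \<subseteq> {a}"
      using K(2) h by (auto simp: bij_betw_def dest: inj_onD)
    with dicycle_singleton[OF K(1)] assms(2) show False
      by blast
  qed
  then show ?thesis
    by blast
qed

lemma dicycle_Restr:
  assumes "K \<subseteq> A"
  shows "dicycle (Restr E A) K \<longleftrightarrow> dicycle E K"
proof -
  have "successively (\<lambda>a b. (a, b) \<in> Restr E A) xs \<longleftrightarrow> successively (\<lambda>a b. (a, b) \<in> E) xs"
    if "set xs \<subseteq> A" for xs
    using that by (induction xs rule: induct_list012) auto
  moreover have "last xs \<in> A" "hd xs \<in> A" if "set xs \<subseteq> A" "xs \<noteq> []" for xs
    using that by auto
  ultimately show ?thesis
    using assms unfolding dicycle_def dipath_def by auto
qed

lemma colouring_Restr: "colouring (Restr E A) A k c \<longleftrightarrow> colouring E A k c"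
proof -
  have "dicycle (Restr E A) K \<longleftrightarrow> dicycle E K" if "K \<subseteq> {v \<in> A. c v = i}" for K i
    using that by (intro dicycle_Restr) auto
  then show ?thesis
    unfolding colouring_def by blast
qed

text \<open>The colours of \<open>d\<close> are moved above those of \<open>c\<close>, so no class
  mixes the two sets.\<close>

lemma colouring_Un:
  assumes "colouring E A k c" "colouring E B l d" "A \<inter> B = {}"
  shows "colouring E (A \<union> B) (k + l) (\<lambda>v. if v \<in> A then c v else k + d v)"
  unfolding colouring_def
proof (intro conjI ballI allI impI notI)
  let ?c = "\<lambda>v. if v \<in> A then c v else k + d v"
  have A: "c v \<in> {1..k}" if "v \<in> A" for v
    using assms(1) that by (auto simp: colouring_def)
  have B: "d v \<in> {1..l}" if "v \<in> B" for v
    using assms(2) that by (auto simp: colouring_def)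
  show "?c ` (A \<union> B) \<subseteq> {1..k + l}"
    using A B by fastforce
  fix i K assume i: "i \<in> {1..k + l}" and K: "dicycle E K" "K \<subseteq> {v \<in> A \<union> B. ?c v = i}"
  show False
  proof (cases "i \<le> k")
    case True
    then have "K \<subseteq> {v \<in> A. c v = i}"
      using K(2) B by (fastforce split: if_splits)
    then show False
      using assms(1) K(1) i True by (auto simp: colouring_def)
  next
    case False
    then have "K \<subseteq> {v \<in> B. d v = i - k}"
      using K(2) A by (fastforce split: if_splits)
    moreover have "i - k \<in> {1..l}"
      using i False by auto
    ultimately show False
      using assms(2) K(1) unfolding colouring_def by blast
  qed
qed

lemma dichromatic_number_le: "colouring (parcs D) (pverts D) k c \<Longrightarrow> dichromatic_number D \<le> k"
  unfolding dichromatic_number_def acyclic_colouring_iff by (intro Least_le) blast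

lemma ex_colouring_dichromatic_number:
  assumes "finite (pverts D)" "\<And>a. (a, a) \<notin> parcs D"
  obtains c where "colouring (parcs D) (pverts D) (dichromatic_number D) c"
  using LeastI_ex[OF ex_colouring[OF assms]] that
  unfolding dichromatic_number_def acyclic_colouring_iff by blast

section \<open>Subdivisions as realisations\<close>

lemma realises_mono: "realises E W B R P \<Longrightarrow> E \<subseteq> E' \<Longrightarrow> realises E' W B R P"
  unfolding realises_def using dipath_mono[of E _ E'] by simp

text \<open>The vertex part \<open>g\<close> of the isomorphism onto the copy \<open>H'\<close>
  names the branch vertices. Since arcs are pairs, it also determines the arc part.\<close>

lemma contains_subdivisionD:
  assumes "contains_subdivision D H"
  obtains g P W where "inj_on g (pverts H)" "W \<subseteq> pverts D"
    "realises (parcs D) W (g ` pverts H) (map_prod g g ` parcs H) P"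
proof -
  obtain S H' where S: "subgraph (with_proj S) (with_proj D)" and iso: "digraph_iso (with_proj H) (with_proj H')"
    and sub: "subdivision_of S H'"
    using assms unfolding contains_subdivision_def by (elim exE conjE)
  obtain h where h: "pre_digraph.digraph_isomorphism (with_proj H) h" "with_proj H' = app_iso h (with_proj H)"
    using iso unfolding digraph_iso_def by (elim exE conjE)
  define g where "g = iso_verts h"
  have "inj_on g (pverts H)"
    using h(1) by (simp add: pre_digraph.digraph_isomorphism_def g_def)
  \<comment> \<open>Equality of the two digraph records forces the tail and head maps of
    \<open>h\<close> to be \<open>fst\<close> and \<open>snd\<close>.\<close>
  have H': "pverts H' = g ` pverts H" "parcs H' = iso_arcs h ` parcs H" "iso_tail h = fst" "iso_head h = snd"
    using h(2) unfolding with_proj_def app_iso_def g_def by simp_all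
  have "iso_arcs h e = map_prod g g e" if "e \<in> parcs H" for e
  proof -
    have "fst (iso_arcs h e) = g (fst e)" "snd (iso_arcs h e) = g (snd e)"
      using h(1) that by (simp_all add: pre_digraph.digraph_isomorphism_def g_def H'(3,4))
    then show ?thesis
      by (simp add: prod_eq_iff)
  qed
  then have arcs: "parcs H' = map_prod g g ` parcs H"
    unfolding H'(2) by (intro image_cong) simp_all
  let ?I = "\<lambda>p. set (pre_digraph.inner_verts (with_proj S) p)"
  obtain P where P: "\<forall>e \<in> parcs H'. pre_digraph.apath (with_proj S) (fst e) (P e) (snd e)"
      "\<forall>e \<in> parcs H'. ?I (P e) \<inter> pverts H' = {}"
      "\<forall>e \<in> parcs H'. \<forall>e' \<in> parcs H'. e \<noteq> e' \<longrightarrow> ?I (P e) \<inter> ?I (P e') = {}"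
      "pverts S = pverts H' \<union> (\<Union>e \<in> parcs H'. ?I (P e))"
    using sub unfolding subdivision_of_def by (elim exE conjE)
  have wf: "wf_digraph (with_proj S)" and sub: "pverts S \<subseteq> pverts D" "parcs S \<subseteq> parcs D"
    using S by (auto simp: subgraph_def)
  define P' where "P' e = pawalk_verts (fst e) (P e)" for e
  have inner: "set (pre_digraph.inner_verts (with_proj S) (P e)) = set (P' e) - {fst e, snd e}"
    if "e \<in> parcs H'" for e
    using wf_digraph.set_inner_verts[OF wf bspec[OF P(1) that]] by (simp add: awalk_verts_with_proj_eq P'_def)
  have path: "dipath (parcs S) (P' e) \<and> hd (P' e) = fst e \<and> last (P' e) = snd e \<and> set (P' e) \<subseteq> pverts S"
    if "e \<in> parcs H'" for e
  proof -
    have awalk: "pre_digraph.awalk (with_proj S) (fst e) (P e) (snd e)" and "distinct (P' e)"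
      using bspec[OF P(1) that] by (simp_all add: pre_digraph.apath_def awalk_verts_with_proj_eq P'_def)
    have "pcas (fst e) (P e) (snd e)" "set (P e) \<subseteq> parcs S"
      using awalk by (auto simp: pre_digraph.awalk_def cas_with_proj_eq)
    note walk = pawalk_verts_walk[OF this, folded P'_def]
    have "set (P' e) \<subseteq> pverts S"
      using awalk wf_digraph.awalk_conv[OF wf, of "fst e" "P e" "snd e"]
      by (simp add: awalk_verts_with_proj_eq P'_def)
    with walk \<open>distinct (P' e)\<close> show ?thesis
      by (simp add: dipath_def)
  qed
  have "realises (parcs S) (pverts S) (pverts H') (parcs H') P'"
    unfolding realises_def
  proof (intro conjI ballI impI)
    show "pverts H' \<subseteq> pverts S"
      using P(4) by blast
  next
    fix e e' assume "e \<in> parcs H'" "e' \<in> parcs H'" "e \<noteq> e'"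
    then show "(set (P' e) - {fst e, snd e}) \<inter> (set (P' e') - {fst e', snd e'}) = {}"
      using P(3) by (metis inner)
  qed (use path inner P(2) in \<open>simp_all\<close>)
  then have "realises (parcs D) (pverts S) (g ` pverts H) (map_prod g g ` parcs H) P'"
    unfolding H'(1) arcs by (rule realises_mono[OF _ sub(2)])
  then show thesis
    using that \<open>inj_on g (pverts H)\<close> sub(1) by blast
qed

text \<open>The subdivision consists of exactly the branch vertices and the paths, so
  \<open>W\<close> and \<open>D\<close> may be larger. The copy \<open>H'\<close> is the image of
  \<open>H\<close> under \<open>g\<close>.\<close>

lemma contains_subdivisionI:
  assumes "pair_wf_digraph D" "pair_wf_digraph H" "inj_on g (pverts H)" "W \<subseteq> pverts D"
    and "realises (parcs D) W (g ` pverts H) (map_prod g g ` parcs H) P"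
  shows "contains_subdivision D H"
proof -
  define H' where "H' = \<lparr>pverts = g ` pverts H, parcs = map_prod g g ` parcs H\<rparr>"
  define S where "S = \<lparr>pverts = pverts H' \<union> (\<Union>e \<in> parcs H'. set (P e)),
    parcs = (\<Union>e \<in> parcs H'. set (arcs_along (P e)))\<rparr>"
  have H: "e \<in> pverts H \<times> pverts H" if "e \<in> parcs H" for e
    using that pair_wf_digraph.arc_fst_in_verts[OF assms(2)] pair_wf_digraph.arc_snd_in_verts[OF assms(2)]
    by (cases e) auto
  have H': "fst e \<in> pverts H'" "snd e \<in> pverts H'" if "e \<in> parcs H'" for e
    using that H by (auto simp: H'_def)
  have R: "realises (parcs D) W (pverts H') (parcs H') P"
    using assms(5) by (simp only: H'_def pair_pre_digraph.simps)
  then have P: "pverts H' \<subseteq> W" "\<And>e. e \<in> parcs H' \<Longrightarrow> dipath (parcs D) (P e)" "\<And>e. e \<in> parcs H' \<Longrightarrow> hd (P e) = fst e"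
      "\<And>e. e \<in> parcs H' \<Longrightarrow> last (P e) = snd e" "\<And>e. e \<in> parcs H' \<Longrightarrow> set (P e) \<subseteq> W"
      "\<And>e. e \<in> parcs H' \<Longrightarrow> (set (P e) - {fst e, snd e}) \<inter> pverts H' = {}"
      "\<And>e e'. e \<in> parcs H' \<Longrightarrow> e' \<in> parcs H' \<Longrightarrow> e \<noteq> e' \<Longrightarrow>
        (set (P e) - {fst e, snd e}) \<inter> (set (P e') - {fst e', snd e'}) = {}"
    using R by (simp_all add: realises_def)
  note walk = arcs_along_walk[of "P e" "parcs D" for e]
  have PD: "P e \<noteq> []" "successively (\<lambda>a b. (a, b) \<in> parcs D) (P e)" "distinct (P e)" if "e \<in> parcs H'" for e
    using P(2)[OF that] by (simp_all add: dipath_def)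
  have "subgraph (with_proj S) (with_proj D)"
    unfolding subgraph_def
  proof (intro conjI)
    show "verts (with_proj S) \<subseteq> verts (with_proj D)"
      using P(1,5) assms(4) by (simp add: S_def) blast
    show "arcs (with_proj S) \<subseteq> arcs (with_proj D)"
      using walk(3) PD by (simp add: S_def) blast
    show "wf_digraph (with_proj D)"
      using assms(1) by (simp add: wf_digraph_wp_iff)
    have "e' \<in> pverts S \<times> pverts S" if "e' \<in> parcs S" for e'
      using that walk(4) PD unfolding S_def by simp blast
    then have "pair_wf_digraph S"
      by unfold_locales (auto simp: mem_Times_iff)
    then show "wf_digraph (with_proj S)"
      by (simp add: wf_digraph_wp_iff)
    show "compatible (with_proj D) (with_proj S)"
      by (simp add: compatible_def)
  qed
  moreover have "digraph_iso (with_proj H) (with_proj H')"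
  proof -
    let ?h = "\<lparr>iso_verts = g, iso_arcs = map_prod g g, iso_head = snd, iso_tail = fst\<rparr>"
    have "inj_on (map_prod g g) (parcs H)"
      using inj_on_subset[OF map_prod_inj_on[OF assms(3,3)]] H by blast
    then have "pre_digraph.digraph_isomorphism (with_proj H) ?h"
      using assms(2,3) by (simp add: pre_digraph.digraph_isomorphism_def wf_digraph_wp_iff)
    moreover have "with_proj H' = app_iso ?h (with_proj H)"
      by (simp add: app_iso_def with_proj_def H'_def)
    ultimately show ?thesis
      unfolding digraph_iso_def by blast
  qed
  moreover have "subdivision_of S H'"
  proof -
    have wfS: "wf_digraph (with_proj S)"
      using \<open>subgraph (with_proj S) (with_proj D)\<close> by (simp add: subgraph_def)
    have path: "pre_digraph.apath (with_proj S) (fst e) (arcs_along (P e)) (snd e)"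
      and verts: "pawalk_verts (fst e) (arcs_along (P e)) = P e" if "e \<in> parcs H'" for e
    proof -
      note w = walk[OF PD(1,2)[OF that], unfolded P(3,4)[OF that]]
      show "pawalk_verts (fst e) (arcs_along (P e)) = P e"
        by (rule w(2))
      have "set (arcs_along (P e)) \<subseteq> parcs S" "fst e \<in> pverts S"
        using that H'(1)[OF that] by (auto simp: S_def)
      then show "pre_digraph.apath (with_proj S) (fst e) (arcs_along (P e)) (snd e)"
        using w(1,2) PD(3)[OF that]
        by (simp add: pre_digraph.apath_def pre_digraph.awalk_def cas_with_proj_eq awalk_verts_with_proj_eq)
    qed
    have inner: "set (pre_digraph.inner_verts (with_proj S) (arcs_along (P e))) = set (P e) - {fst e, snd e}"
      if "e \<in> parcs H'" for e
      using wf_digraph.set_inner_verts[OF wfS path[OF that]] verts[OF that]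
      by (simp add: awalk_verts_with_proj_eq)
    have "pverts S = pverts H' \<union> (\<Union>e \<in> parcs H'. set (P e) - {fst e, snd e})"
      using H' by (auto simp: S_def)
    then have "pverts S = pverts H' \<union>
        (\<Union>e \<in> parcs H'. set (pre_digraph.inner_verts (with_proj S) (arcs_along (P e))))"
      using inner by simp
    moreover have "parcs S = (\<Union>e \<in> parcs H'. set (arcs_along (P e)))"
      by (simp add: S_def)
    ultimately show ?thesis
      unfolding subdivision_of_def using path inner P(6,7)
      by (intro exI[of _ "\<lambda>e. arcs_along (P e)"]) simp
  qed
  ultimately show ?thesis
    unfolding contains_subdivision_def by blast
qed

section \<open>Good subdigraphs of a bioriented path\<close>

lemma links_nth:
  assumes "length ws = Suc (length es)"
  shows "links ws es = {(ws ! i, ws ! Suc i) | i. i < length es \<and> fst (es ! i)} \<union>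
    {(ws ! Suc i, ws ! i) | i. i < length es \<and> snd (es ! i)}"
  using assms
proof (induction es arbitrary: ws)
  case Nil
  then show ?case by (cases ws) auto
next
  case (Cons e es)
  then obtain a b ws' where ws: "ws = a # b # ws'"
    by (cases ws; cases "tl ws") auto
  have IH: "links (b # ws') es = {((b # ws') ! i, (b # ws') ! Suc i) | i. i < length es \<and> fst (es ! i)} \<union>
    {((b # ws') ! Suc i, (b # ws') ! i) | i. i < length es \<and> snd (es ! i)}"
    using Cons.prems by (intro Cons.IH) (simp add: ws)
  show ?case
  proof (intro set_eqI)
    fix z
    have "z \<in> links ws (e # es) \<longleftrightarrow> (fst e \<and> z = (a, b)) \<or> (snd e \<and> z = (b, a)) \<or> z \<in> links (b # ws') es"
      by (auto simp: ws)
    also have "\<dots> \<longleftrightarrow> (\<exists>i < Suc (length es). fst ((e # es) ! i) \<and> z = (ws ! i, ws ! Suc i)) \<or>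
        (\<exists>i < Suc (length es). snd ((e # es) ! i) \<and> z = (ws ! Suc i, ws ! i))"
      unfolding IH ex_simps(1) by (simp add: ws Ex_less_Suc2) blast
    finally show "z \<in> links ws (e # es) \<longleftrightarrow>
        z \<in> {(ws ! i, ws ! Suc i) | i. i < length (e # es) \<and> fst ((e # es) ! i)} \<union>
          {(ws ! Suc i, ws ! i) | i. i < length (e # es) \<and> snd ((e # es) ! i)}"
      by auto
  qed
qed

locale good_path =
  fixes v :: "nat \<Rightarrow> 'a" and k :: nat and Q :: "'a pair_pre_digraph"
  assumes k_pos: "1 \<le> k" and inj_v: "inj_on v {1..k}" and good: "Q \<in> good_subdigraphs v k"
begin

lemma pverts_Q: "pverts Q = v ` {1..k}"
proof (rule card_subset_eq)
  show "pverts Q \<subseteq> v ` {1..k}"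
    using good by (simp add: good_subdigraphs_def subgraph_def bioriented_path_def biorientation_def)
  show "card (pverts Q) = card (v ` {1..k})"
    using good card_image[OF inj_v] by (simp add: good_subdigraphs_def)
qed simp

lemma parcs_Q_cases:
  assumes "e \<in> parcs Q"
  obtains i where "1 \<le> i" "i < k" "e = (v i, v (Suc i)) \<or> e = (v (Suc i), v i)"
proof -
  have "e \<in> parcs (bioriented_path v k)"
    using good assms by (auto simp: good_subdigraphs_def subgraph_def)
  then obtain i where "1 \<le> i" "i < k" "{fst e, snd e} = {v i, v (Suc i)}"
    by (auto simp: bioriented_path_def biorientation_def)
  then show thesis
    using that by (cases e) (auto simp: doubleton_eq_iff)
qed

lemma v_eq_iff: "i \<in> {1..k} \<Longrightarrow> j \<in> {1..k} \<Longrightarrow> v i = v j \<longleftrightarrow> i = j"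
  using inj_v by (auto dest: inj_onD)

text \<open>Each edge of a path is a bridge: if both arcs were missing, the set of
  \<open>v 1\<close> to \<open>v i\<close> would be closed under adjacency in \<open>Q\<close>,
  contrary to connectedness.\<close>

lemma edge_present:
  assumes "1 \<le> i" "i < k"
  shows "(v i, v (Suc i)) \<in> parcs Q \<or> (v (Suc i), v i) \<in> parcs Q"
proof (rule ccontr)
  assume none: "\<not> ?thesis"
  have closed: "z \<in> v ` {1..i}" if yz: "y \<in> v ` {1..i}" "(y, z) \<in> parcs (mk_symmetric (with_proj Q))" for y z
  proof -
    obtain e where e: "e \<in> parcs Q" "(y, z) = e \<or> (z, y) = e"
      using yz(2) by (auto simp: mk_symmetric_def)
    obtain j where j: "1 \<le> j" "j < k" "e = (v j, v (Suc j)) \<or> e = (v (Suc j), v j)"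
      using parcs_Q_cases[OF e(1)] .
    then have "j \<noteq> i"
      using none e(1) by auto
    obtain l where l: "l \<in> {1..i}" "y = v l"
      using yz(1) by blast
    have "(y = v j \<and> z = v (Suc j)) \<or> (y = v (Suc j) \<and> z = v j)"
      using e(2) j(3) by auto
    then have "(l = j \<and> z = v (Suc j)) \<or> (l = Suc j \<and> z = v j)"
      using l j(1,2) assms(2) v_eq_iff[of l j] v_eq_iff[of l "Suc j"] by auto
    then show ?thesis
      using l(1) \<open>j \<noteq> i\<close> j(1) by auto
  qed
  have "v i \<in> pverts Q" "v (Suc i) \<in> pverts Q"
    using assms by (auto simp: pverts_Q)
  moreover have "connected (with_proj Q)"
    using good by (simp add: good_subdigraphs_def)
  ultimately have "v i \<rightarrow>\<^sup>*\<^bsub>with_proj (mk_symmetric (with_proj Q))\<^esub> v (Suc i)"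
    unfolding connected_def strongly_connected_def by (simp add: mk_symmetric_def)
  then have "(v i, v (Suc i)) \<in> rtrancl_on (pverts Q) (parcs (mk_symmetric (with_proj Q)))"
    by (simp add: reachable_def mk_symmetric_def)
  then have "v (Suc i) \<in> v ` {1..i}"
  proof (induction rule: rtrancl_on_induct)
    case base
    then show ?case using assms(1) by simp
  next
    case (step y z)
    then show ?case using closed by blast
  qed
  then obtain l where "l \<in> {1..i}" "v (Suc i) = v l"
    by blast
  then show False
    using v_eq_iff[of "Suc i" l] assms by auto
qed

lemma no_adjacent_digons:
  assumes "1 \<le> i" "Suc i < k" "(v i, v (Suc i)) \<in> parcs Q" "(v (Suc i), v i) \<in> parcs Q"
    "(v (Suc i), v (Suc (Suc i))) \<in> parcs Q" "(v (Suc (Suc i)), v (Suc i)) \<in> parcs Q"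
  shows False
proof -
  have "{v i, v (Suc i)} \<in> digons Q" "{v (Suc i), v (Suc (Suc i))} \<in> digons Q"
    using assms(3-6) by (auto simp: digons_def)
  moreover have "{v i, v (Suc i)} \<noteq> {v (Suc i), v (Suc (Suc i))}"
    using v_eq_iff[of i "Suc (Suc i)"] v_eq_iff[of i "Suc i"] assms(1,2) by (auto simp: doubleton_eq_iff)
  moreover have "pairwise disjnt (digons Q)"
    using good by (simp add: good_subdigraphs_def)
  ultimately have "disjnt {v i, v (Suc i)} {v (Suc i), v (Suc (Suc i))}"
    by (meson pairwiseD)
  then show False
    by (simp add: disjnt_def)
qed

lemma no_first_digon:
  assumes "2 \<le> k" "(v 1, v 2) \<in> parcs Q" "(v 2, v 1) \<in> parcs Q"
  shows False
proof -
  have "parcs Q \<subseteq> pverts Q \<times> pverts Q"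
    using good by (auto simp: good_subdigraphs_def subgraph_def wf_digraph_def)
  \<comment> \<open>Degrees are cardinalities, which are \<open>0\<close> for infinite sets;
    finiteness makes a present arc count.\<close>
  then have fin: "finite (parcs Q)"
    using pverts_Q finite_subset by (metis finite_SigmaI finite_atLeastAtMost finite_imageI)
  have "card (out_arcs (with_proj Q) (v 1)) \<noteq> 0" "card (in_arcs (with_proj Q) (v 1)) \<noteq> 0"
    using assms(2,3) fin by (auto simp: out_arcs_def in_arcs_def)
  then show False
    using good assms(1) by (simp add: good_subdigraphs_def out_degree_def in_degree_def)
qed

end

section \<open>The main theorem\<close>

text \<open>For \<open>k = 1\<close> the closed sequence is \<open>x, w, x\<close> and its second
  step carries no arc, so any cycle through \<open>x\<close> realises the remaining digon. For
  larger \<open>k\<close> the chain of cycles is used.\<close>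

lemma realise_rooted_cycle:
  assumes "shift E X x k c" "\<And>c'. \<not> colouring E (insert x X) k c'" "length es = k"
    and "k = 1 \<longrightarrow> es = [(False, False)]"
    and "2 \<le> k \<longrightarrow> (\<forall>e \<in> set es. fst e \<or> snd e)"
    and "2 \<le> k \<longrightarrow> successively (\<lambda>e e'. \<not> (digon e \<and> digon e')) es"
    and "2 \<le> k \<longrightarrow> \<not> digon (hd es)" "2 \<le> k \<longrightarrow> \<not> digon (last es)"
  obtains ws P W where "length ws = Suc k" "distinct ws" "last ws = x" "W \<subseteq> insert x X"
    "realises E W (set (x # ws)) (links (x # ws) ((True, True) # es)) P"
proof -
  interpret shift E X x k c
    by fact
  consider "k = 1" | "2 \<le> k"
    using k_pos by linarith
  then show thesis
  proof cases
    case 1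
    obtain K where K: "dicycle E K" "x \<in> K" "K \<subseteq> insert x X"
      using ex_dicycle_through[OF assms(2)] .
    then obtain w where w: "w \<in> K" "w \<noteq> x"
      using dicycle_singleton[OF K(1), of x] loopless by blast
    obtain P where "realises E K {x, w} {(x, w), (w, x)} P"
      using realise_digon[OF K(1,2) w(1)] w(2) by metis
    moreover have "links (x # [w, x]) ((True, True) # es) = {(x, w), (w, x)}" "set (x # [w, x]) = {x, w}"
      using assms(4) 1 by auto
    ultimately show thesis
      using 1 w(2) K(3) by (intro that[of "[w, x]" K P]) simp_all
  next
    case 2
    show thesis
      by (rule realise_cycle[OF 2 assms(2,3) assms(5-8)[THEN mp, OF 2]]) (assumption | rule that)+
  qed
qed

text \<open>The subdivision of \<open>F\<close> lies in \<open>W\<^sub>0\<close>, the realisation of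
  the added arcs in \<open>insert x X\<close> with \<open>x = f v0\<close>. They share only
  \<open>x\<close> and can be glued.\<close>

lemma contains_extension:
  fixes D :: "'b pair_pre_digraph" and F F' Q :: "'a pair_pre_digraph"
  assumes "pair_wf_digraph F" "v0 \<in> pverts F" "good_path v k Q" "v ` {1..k} \<inter> pverts F = {}"
    and C: "if 2 \<le> k then C = {(v0, v k)} \<or> C = {(v k, v0)} else C = {}"
    and F': "F' = \<lparr>pverts = pverts F \<union> pverts Q,
               parcs = parcs F \<union> parcs Q \<union> {(v0, v 1), (v 1, v0)} \<union> C\<rparr>"
    and D: "pair_wf_digraph D" "\<And>a. (a, a) \<notin> parcs D" "finite X" "X \<inter> W\<^sub>0 = {}" "W\<^sub>0 \<union> X \<subseteq> pverts D"
    and X: "colouring (parcs D) X k c" "\<And>x c'. x \<in> W\<^sub>0 \<Longrightarrow> \<not> colouring (parcs D) (insert x X) k c'"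
    and f: "inj_on f (pverts F)"
      "realises (parcs D) W\<^sub>0 (f ` pverts F) (map_prod f f ` parcs F) P\<^sub>0"
  shows "contains_subdivision D F'"
proof -
  interpret good_path v k Q
    by fact
  let ?E = "parcs D"
  define x where "x = f v0"
  \<comment> \<open>The closed sequence \<open>v0, v 1, ..., v k, v0\<close> carries all added arcs.
    The entries of \<open>es\<close> belong to its steps after the initial digon:
    \<open>k - 1\<close> steps along \<open>Q\<close> and a last one from \<open>v k\<close> to
    \<open>v0\<close>, which is empty if \<open>k = 1\<close>.\<close>
  define es where "es = map (\<lambda>i. ((v i, v (Suc i)) \<in> parcs Q, (v (Suc i), v i) \<in> parcs Q)) [1..<k] @
    [(C = {(v k, v0)}, C = {(v0, v k)})]"
  define vs where "vs = map v [1..<Suc k] @ [v0]"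
  have len: "length es = k" "length vs = Suc k"
    using k_pos by (simp_all add: es_def vs_def)
  have es_nth: "es ! i = ((v (Suc i), v (Suc (Suc i))) \<in> parcs Q, (v (Suc (Suc i)), v (Suc i)) \<in> parcs Q)"
    if "Suc i < k" for i
  proof -
    have "i < k - 1"
      using that by simp
    then show ?thesis
      by (simp add: es_def nth_append)
  qed
  have es_last: "es ! (k - 1) = (C = {(v k, v0)}, C = {(v0, v k)})"
    by (simp add: es_def nth_append)
  have vs_nth: "vs ! i = v (Suc i)" if "i < k" for i
    using that by (simp add: vs_def nth_append del: upt_Suc)
  have vs_last: "vs ! k = v0"
    using k_pos by (simp add: vs_def nth_append del: upt_Suc)
  have v0: "v0 \<notin> v ` {1..k}"
    using assms(2,4) by blast
  \<comment> \<open>The first entry is not a digon by the degree condition on \<open>v 1\<close>,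
    the last one because \<open>C\<close> is a single arc.\<close>
  have nd: "\<not> digon (es ! i)" if "i = 0 \<or> i = k - 1" "2 \<le> k" for i
  proof (cases "i = k - 1")
    case True
    have "v k \<noteq> v0"
      using v0 k_pos by auto
    then show ?thesis
      using True es_last by auto
  next
    case False
    with that show ?thesis
      using no_first_digon es_nth[of 0] by (auto simp: numeral_2_eq_2)
  qed
  have "x \<in> W\<^sub>0"
    using f(2) assms(2) by (auto simp: realises_def x_def)
  have shift: "shift ?E X x k c"
    using D \<open>x \<in> W\<^sub>0\<close> k_pos X(1) by unfold_locales auto
  have "k = 1 \<longrightarrow> es = [(False, False)]"
    using C by (simp add: es_def)
  moreover have "2 \<le> k \<longrightarrow> (\<forall>e \<in> set es. fst e \<or> snd e)"
  proof (intro impI ballI)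
    fix e assume "2 \<le> k" and "e \<in> set es"
    then obtain i where i: "i < k" "e = es ! i"
      using len by (auto simp: in_set_conv_nth)
    show "fst e \<or> snd e"
    proof (cases "i = k - 1")
      case True
      then show ?thesis using i(2) es_last C \<open>2 \<le> k\<close> by auto
    next
      case False
      then show ?thesis using i es_nth[of i] edge_present[of "Suc i"] by auto
    qed
  qed
  moreover have "2 \<le> k \<longrightarrow> successively (\<lambda>e e'. \<not> (digon e \<and> digon e')) es"
    unfolding successively_conv_nth
  proof (intro allI impI)
    fix i assume "2 \<le> k" and "Suc i < length es"
    then have i: "Suc i < k"
      by (simp add: len)
    show "\<not> (digon (es ! i) \<and> digon (es ! Suc i))"
    proof (cases "Suc i = k - 1")
      case True
      then show ?thesis using nd[of "Suc i"] \<open>2 \<le> k\<close> by auto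
    next
      case False
      then have "Suc (Suc i) < k"
        using i by simp
      then show ?thesis
        using i es_nth[of i] es_nth[of "Suc i"] no_adjacent_digons[of "Suc i"] by auto
    qed
  qed
  moreover have ends: "hd es = es ! 0" "last es = es ! (k - 1)"
    using len(1) k_pos hd_conv_nth[of es] last_conv_nth[of es] by (cases es; simp)+
  have "2 \<le> k \<longrightarrow> \<not> digon (hd es)" "2 \<le> k \<longrightarrow> \<not> digon (last es)"
    using nd[of 0] nd[of "k - 1"] unfolding ends by blast+
  ultimately obtain ws P W where ws: "length ws = Suc k" "distinct ws" "last ws = x" and W: "W \<subseteq> insert x X"
      "realises ?E W (set (x # ws)) (links (x # ws) ((True, True) # es)) P"
    by (rule realise_rooted_cycle[OF shift X(2)[OF \<open>x \<in> W\<^sub>0\<close>] len(1)])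
  have ws_last: "ws ! k = x"
    using ws(1,3) last_conv_nth[of ws] by (cases ws) simp_all
  \<comment> \<open>The vertices of the path are numbered from \<open>1\<close>, list positions from
    \<open>0\<close>; hence \<open>v i\<close> goes to position \<open>i - 1\<close> of
    \<open>ws\<close>.\<close>
  define g where "g u = (if u \<in> pverts F then f u else ws ! (the_inv_into {1..k} v u - 1))" for u
  have g_F: "g u = f u" if "u \<in> pverts F" for u
    using that by (simp add: g_def)
  have g_v: "g (v (Suc i)) = ws ! i" if "i < k" for i
  proof -
    have "v (Suc i) \<in> v ` {1..k}"
      using that by simp
    then have "v (Suc i) \<notin> pverts F"
      using assms(4) by blast
    then show ?thesis
      using the_inv_into_f_f[OF inj_v, of "Suc i"] that by (simp add: g_def)
  qed
  have g_vs: "map g vs = ws"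
  proof (rule nth_equalityI)
    fix i assume "i < length (map g vs)"
    then show "map g vs ! i = ws ! i"
      using g_v vs_nth vs_last ws_last g_F assms(2) len(2) by (cases "i = k") (auto simp: x_def)
  qed (simp add: len ws)
  have set_vs: "set (v0 # vs) = insert v0 (pverts Q)"
    by (simp add: vs_def pverts_Q atLeastLessThanSuc_atLeastAtMost del: upt_Suc)
  have g_set: "set (x # ws) = insert x (g ` pverts Q)"
  proof -
    have "set (x # ws) = g ` set (v0 # vs)"
      unfolding g_vs[symmetric] by (simp add: g_F[OF assms(2)] x_def)
    then show ?thesis
      unfolding set_vs by (simp add: g_F[OF assms(2)] x_def)
  qed
  have links_vs: "links vs es = parcs Q \<union> C"
  proof (intro equalityI subsetI)
    fix e assume "e \<in> links vs es"
    then obtain i where i: "i < k" "(fst (es ! i) \<and> e = (vs ! i, vs ! Suc i)) \<or>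
        (snd (es ! i) \<and> e = (vs ! Suc i, vs ! i))"
      using links_nth[of vs es] len by auto
    show "e \<in> parcs Q \<union> C"
    proof (cases "Suc i = k")
      case True
      then have "i = k - 1" "vs ! i = v k" "vs ! Suc i = v0"
        using i(1) vs_nth vs_last by auto
      then show ?thesis
        using i(2) es_last by auto
    next
      case False
      then show ?thesis
        using i es_nth[of i] vs_nth by auto
    qed
  next
    have sub: "(vs ! i, vs ! Suc i) \<in> links vs es \<or> \<not> fst (es ! i)"
        "(vs ! Suc i, vs ! i) \<in> links vs es \<or> \<not> snd (es ! i)" if "i < k" for i
      using that links_nth[of vs es] len by auto
    fix e assume "e \<in> parcs Q \<union> C"
    then show "e \<in> links vs es"
    proof
      assume "e \<in> parcs Q"
      then obtain j where j: "1 \<le> j" "j < k" "e = (v j, v (Suc j)) \<or> e = (v (Suc j), v j)"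
        by (rule parcs_Q_cases)
      then obtain i where "j = Suc i"
        by (cases j) auto
      then show ?thesis
        using j \<open>e \<in> parcs Q\<close> sub[of i] es_nth[of i] vs_nth[of i] vs_nth[of "Suc i"] by auto
    next
      assume "e \<in> C"
      then show ?thesis
        using C sub[of "k - 1"] es_last vs_nth[of "k - 1"] vs_last k_pos by (auto split: if_splits)
    qed
  qed
  have "vs \<noteq> []" "hd vs = v 1"
    using k_pos len(2) vs_nth[of 0] by (cases vs; simp)+
  then have "links (v0 # vs) ((True, True) # es) = {(v0, v 1), (v 1, v0)} \<union> parcs Q \<union> C"
    using links_Cons[of vs v0 "(True, True)" es] links_vs by auto
  then have g_links: "map_prod g g ` ({(v0, v 1), (v 1, v0)} \<union> parcs Q \<union> C) =
      links (x # ws) ((True, True) # es)"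
    using links_map[of g "v0 # vs" "(True, True) # es"] g_vs g_F[OF assms(2)] by (simp add: x_def)
  have "map_prod g g ` parcs F = map_prod f f ` parcs F"
    using pair_wf_digraph.arc_fst_in_verts[OF assms(1)] pair_wf_digraph.arc_snd_in_verts[OF assms(1)]
    by (intro image_cong) (auto simp: g_F)
  then have g_arcs: "map_prod g g ` parcs F' = map_prod f f ` parcs F \<union> links (x # ws) ((True, True) # es)"
    unfolding g_links[symmetric] F' by (simp add: image_Un Un_ac)
  have "g ` pverts F = f ` pverts F"
    using g_F by simp
  then have g_verts: "g ` pverts F' = f ` pverts F \<union> set (x # ws)"
    using assms(2) unfolding g_set F' by (auto simp: x_def)
  have FW: "f ` pverts F \<subseteq> W\<^sub>0"
    using f(2) by (simp add: realises_def)
  have "W\<^sub>0 \<inter> W \<subseteq> f ` pverts F \<inter> set (x # ws)"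
    using W(1) D(4) assms(2) by (auto simp: x_def)
  from realises_Un[OF f(2) W(2) this] obtain P'
    where "realises ?E (W\<^sub>0 \<union> W) (g ` pverts F') (map_prod g g ` parcs F') P'"
    unfolding g_arcs g_verts by blast
  moreover have "W\<^sub>0 \<union> W \<subseteq> pverts D"
    using W(1) \<open>x \<in> W\<^sub>0\<close> D(5) by blast
  moreover have "inj_on g (pverts F')"
  proof -
    have v_X: "g (v (Suc i)) \<in> X" if "i < k" for i
    proof -
      \<comment> \<open>Since \<open>x\<close> is the last entry of the duplicate-free list
        \<open>ws\<close>, the images of the vertices of \<open>Q\<close> differ from
        \<open>x\<close>. They therefore lie in \<open>X\<close>, away from the subdivision of
        \<open>F\<close>.\<close>
      have "ws ! i \<noteq> ws ! k"
        using that ws(1,2) by (simp add: nth_eq_iff_index_eq)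
      moreover have "ws ! i \<in> W"
        using W(2) that ws(1) by (auto simp: realises_def)
      ultimately show ?thesis
        using W(1) g_v[OF that] ws_last by auto
    qed
    have Q: "\<exists>i<k. u = v (Suc i)" if "u \<in> pverts Q" for u
      using that unfolding pverts_Q by (auto simp: image_iff Suc_le_eq) (metis Suc_le_eq Suc_pred)
    have "inj_on g (pverts F)"
      using f(1) g_F by (simp cong: inj_on_cong)
    moreover have "inj_on g (pverts Q)"
    proof (rule inj_onI)
      fix u w assume "u \<in> pverts Q" "w \<in> pverts Q" "g u = g w"
      then obtain i j where "i < k" "j < k" "u = v (Suc i)" "w = v (Suc j)" "ws ! i = ws ! j"
        using Q[of u] Q[of w] g_v by metis
      then show "u = w"
        using ws(1,2) by (simp add: nth_eq_iff_index_eq)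
    qed
    moreover have "g ` pverts F \<inter> g ` pverts Q = {}"
    proof -
      have "g ` pverts Q \<subseteq> X"
        using Q v_X by blast
      moreover have "g ` pverts F \<subseteq> W\<^sub>0"
        using FW g_F by auto
      ultimately show ?thesis
        using D(4) by blast
    qed
    ultimately show ?thesis
      unfolding F' by (auto simp: inj_on_Un)
  qed
  moreover have "pair_wf_digraph F'"
  proof -
    have "parcs Q \<subseteq> pverts Q \<times> pverts Q"
      using good by (auto simp: good_subdigraphs_def subgraph_def wf_digraph_def)
    moreover have "v 1 \<in> pverts Q" "v k \<in> pverts Q"
      using k_pos by (auto simp: pverts_Q)
    moreover have "C \<subseteq> {(v0, v k), (v k, v0)}"
      using C by (auto split: if_splits)
    moreover have "parcs F \<subseteq> pverts F \<times> pverts F"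
      using pair_wf_digraph.arc_fst_in_verts[OF assms(1)] pair_wf_digraph.arc_snd_in_verts[OF assms(1)] by force
    ultimately have "parcs F' \<subseteq> pverts F' \<times> pverts F'"
      using assms(2) unfolding F' by auto
    then show ?thesis
      by unfold_locales auto
  qed
  ultimately show ?thesis
    using contains_subdivisionI[OF D(1)] by blast
qed

section \<open>The Mader number as an infimum\<close>

lemma mader_leI:
  assumes "\<And>D :: nat pair_pre_digraph. pair_digraph D \<Longrightarrow> m \<le> dichromatic_number D \<Longrightarrow> contains_subdivision D H"
  shows "mader H \<le> enat m"
  unfolding mader_def using assms by (intro Inf_lower) blast

text \<open>A finite infimum is attained: the infimum of the empty set is infinite, and a nonempty
  set of extended naturals has a least element.\<close>

lemma mader_eq_enatD:
  fixes D :: "nat pair_pre_digraph"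
  assumes "mader H = enat m" "pair_digraph D" "m \<le> dichromatic_number D"
  shows "contains_subdivision D H"
proof -
  let ?M = "{enat m | m. \<forall>D :: nat pair_pre_digraph.
     pair_digraph D \<longrightarrow> m \<le> dichromatic_number D \<longrightarrow> contains_subdivision D H}"
  have "Inf ?M = enat m"
    using assms(1) by (simp add: mader_def)
  have "?M \<noteq> {}"
  proof
    assume empty: "?M = {}"
    show False
      using \<open>Inf ?M = enat m\<close> unfolding empty by (simp add: Inf_enat_def)
  qed
  then have "Inf ?M \<in> ?M"
    unfolding Inf_enat_def using LeastI_ex[of "\<lambda>a. a \<in> ?M"] by auto
  then show ?thesis
    using \<open>Inf ?M = enat m\<close> assms(2,3) by auto
qed

theorem theorem3p1:
  fixes F F' Q :: "'a pair_pre_digraph" and v :: "nat \<Rightarrow> 'a" and v0 :: 'a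
    and k :: nat and C :: "('a \<times> 'a) set"
  assumes "pair_digraph F" and "v0 \<in> pverts F"
    and "1 \<le> k"
    and "inj_on v {1..k}" and "v ` {1..k} \<inter> pverts F = {}"
    and "Q \<in> good_subdigraphs v k"
    and "if 2 \<le> k then C = {(v0, v k)} \<or> C = {(v k, v0)} else C = {}"
    and "F' = \<lparr>pverts = pverts F \<union> pverts Q,
               parcs = parcs F \<union> parcs Q \<union> {(v0, v 1), (v 1, v0)} \<union> C\<rparr>"
  shows "mader F' \<le> mader F + enat k"
proof (cases "mader F")
  case infinity
  then show ?thesis by simp
next
  case (enat m)
  have "mader F' \<le> enat (m + k)"
  proof (rule mader_leI)
    fix D :: "nat pair_pre_digraph"
    assume D: "pair_digraph D" and chi: "m + k \<le> dichromatic_number D"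
    interpret D: pair_digraph D
      by fact
    have fin: "finite (pverts D)"
      by (rule D.pair_finite_verts)
    have loopless: "(a, a) \<notin> parcs D" for a
      using D.pair_no_loops by fastforce
    define \<S> where "\<S> = {X. X \<subseteq> pverts D \<and> (\<exists>c. colouring (parcs D) X k c)}"
    have "finite \<S>"
      using fin by (auto simp: \<S>_def intro: finite_subset[of _ "Pow (pverts D)"])
    moreover have "{} \<in> \<S>"
      by (auto simp: \<S>_def colouring_def dest: dicycle_nonempty)
    ultimately obtain X where X: "X \<in> \<S>" and max: "\<And>Y. Y \<in> \<S> \<Longrightarrow> X \<subseteq> Y \<Longrightarrow> X = Y"
      using finite_has_maximal[of \<S>] by blast
    then obtain c where sub: "X \<subseteq> pverts D" and c: "colouring (parcs D) X k c"
      unfolding \<S>_def by blast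
    let ?V = "pverts D - X"
    define D' where "D' = \<lparr>pverts = ?V, parcs = Restr (parcs D) ?V\<rparr>"
    have D': "pair_digraph D'"
      using fin D.pair_finite_arcs loopless by unfold_locales (auto simp: D'_def)
    \<comment> \<open>Colourings of \<open>D'\<close> and of \<open>X\<close> combine with disjoint
      palettes, so deleting \<open>X\<close> lowers the dichromatic number by at most
      \<open>k\<close>.\<close>
    have "m \<le> dichromatic_number D'"
    proof -
      have "finite (pverts D')" "\<And>a. (a, a) \<notin> parcs D'"
        using fin loopless by (simp_all add: D'_def)
      then obtain d where "colouring (parcs D') (pverts D') (dichromatic_number D') d"
        by (rule ex_colouring_dichromatic_number)
      then have "colouring (parcs D) ?V (dichromatic_number D') d"
        by (simp add: D'_def colouring_Restr)
      moreover have "?V \<inter> X = {}" "?V \<union> X = pverts D"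
        using sub by blast+
      ultimately have "dichromatic_number D \<le> dichromatic_number D' + k"
        using colouring_Un[OF _ c] by (metis dichromatic_number_le)
      with chi show ?thesis
        by simp
    qed
    then have "contains_subdivision D' F"
      by (rule mader_eq_enatD[OF enat D'])
    then obtain f P\<^sub>0 W\<^sub>0 where f: "inj_on f (pverts F)" "W\<^sub>0 \<subseteq> pverts D'"
        "realises (parcs D') W\<^sub>0 (f ` pverts F) (map_prod f f ` parcs F) P\<^sub>0"
      by (rule contains_subdivisionD)
    have P\<^sub>0: "realises (parcs D) W\<^sub>0 (f ` pverts F) (map_prod f f ` parcs F) P\<^sub>0"
      using f(3) by (rule realises_mono) (auto simp: D'_def)
    have W\<^sub>0: "W\<^sub>0 \<subseteq> ?V"
      using f(2) by (simp add: D'_def)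
    then have disj: "X \<inter> W\<^sub>0 = {}" "W\<^sub>0 \<union> X \<subseteq> pverts D"
      using sub by blast+
    \<comment> \<open>Maximality of \<open>X\<close> applies to every vertex of \<open>D\<close>
      outside \<open>X\<close>, so it does not matter which of them represents
      \<open>v0\<close>.\<close>
    have uncolourable: "\<not> colouring (parcs D) (insert x X) k c'" if "x \<in> W\<^sub>0" for x c'
    proof
      assume "colouring (parcs D) (insert x X) k c'"
      then have "insert x X \<in> \<S>"
        using sub W\<^sub>0 that unfolding \<S>_def by blast
      with max[of "insert x X"] W\<^sub>0 that show False
        by blast
    qed
    have F: "pair_wf_digraph F"
      using assms(1) by (simp add: pair_digraph_def pair_fin_digraph_def)
    have Q: "good_path v k Q"
      using assms(3,4,6) by unfold_locales
    show "contains_subdivision D F'"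
      by (rule contains_extension[OF F assms(2) Q assms(5,7,8) D.pair_wf_digraph loopless
            finite_subset[OF sub fin] disj c uncolourable f(1) P\<^sub>0])
  qed
  then show ?thesis
    by (simp add: enat)
qed

end
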